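(* Let $\mathcal{B}=\sigma_{j_1}\sigma_{j_2}\cdots$ be any complete semi-infinite positive (right-handed) braid on $n$ strands, with partial braids $\mathcal{B}_\ell=\sigma_{j_1}\cdots\sigma_{j_\ell}$. Then the normalized Kauffman brackets $(-1)^{n^-}q^{-N}\langle \mathcal{B}_\ell\rangle$ (which equal $q^{-\ell}\langle\mathcal{B}_\ell\rangle$ when all strands are oriented upward) stabilize as $\ell\to\infty$ to a power series representation of the Jones-Wenzl projector $P_n$. That is, writing elements of $TL_n$ in the basis of planar crossingless $(n,n)$-tangles without circles, for every basis diagram $D$ and every integer $m$ the coefficient of $q^m D$ in $(-1)^{n^-}q^{-N}\langle \mathcal{B}_\ell\rangle$ is eventually constant in $\ell$, and its eventual value is the coefficient of $q^m$ in the power series expansion in $q$ of the coefficient of $D$ in $P_n$.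
   Context: $\sigma_1,\dots,\sigma_{n-1}$ are the standard braid group generators, each a right-handed crossing (positive when all strands are oriented upward). A semi-infinite positive braid is a semi-infinite word in the $\sigma_i$ (no inverses); it is complete if every $\sigma_i$, $1\le i\le n-1$, occurs infinitely often. $TL_n$ is the Temperley-Lieb algebra over $\mathbb{C}(q)$, generated by planar crossingless $(n,n)$-tangles with multiplication by vertical concatenation and with each circle removed at the cost of a factor $q+q^{-1}$. $I_n$ is the identity and $e_1,\dots,e_{n-1}$ are the standard turnback generators. The Jones-Wenzl projector $P_n\in TL_n$ is the unique element with $P_ne_i=e_iP_n=0$ for all $i$ and with coefficient of $I_n$ equal to 1. The Kauffman bracket $\langle\cdot\rangle$ of an oriented tangle diagram is computed locally as follows. A right-handed crossing, drawn so that its 0-resolution is the vertical smoothing, is replaced by $q\langle\text{vertical}\rangle-q^2\langle\text{horizontal}\rangle$ if it is positive and by $-q^{-2}\langle\text{vertical}\rangle+q^{-1}\langle\text{horizontal}\rangle$ if it is negative. Here $n^\pm$ are the numbers of positive/negative crossings and $N=n^+-2n^-$. Hence $(-1)^{n^-}q^{-N}\langle\mathcal{B}_\ell\rangle=\prod_{m=1}^{\ell}(I_n-q\,e_{j_m})$. *)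

theory Defs
  imports
    "HOL-Computational_Algebra.Computational_Algebra"
    "HOL-Computational_Algebra.Field_as_Ring"
    "HOL-Combinatorics.Transposition"
begin

section \<open>Coefficients\<close>

text \<open>The field of rational functions in the variable q over the complex numbers.\<close>

type_synonym ratfun = "complex poly fract"

definition q :: ratfun where
  "q = to_fract [:0, 1:]"

text \<open>Expansion of a rational function at q = 0. The quotient on the right-hand side is taken
  in the field of formal Laurent series, so a pole at q = 0 is allowed here. On Laurent
  polynomials the coefficients of the expansion are the usual ones.\<close>

definition expansion :: "ratfun \<Rightarrow> complex fls" where
  "expansion x = (case quot_of_fract x of (a, b) \<Rightarrow>
     fps_to_fls (fps_of_poly a) / fps_to_fls (fps_of_poly b))"

section \<open>Planar crossingless tangles\<close>

text \<open>The point \<open>(h, i)\<close> is the \<open>i\<close>-th point from the left on the horizontal line at height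
  \<open>h\<close>. A crossingless \<open>(n, n)\<close>-tangle without circles is given, up to planar isotopy, by the
  matching of its endpoints, encoded as the symmetric relation of being joined by an arc.\<close>

type_synonym point = "nat \<times> nat"
type_synonym diagram = "(point \<times> point) set"

definition level :: "nat \<Rightarrow> nat \<Rightarrow> point set" where
  "level n h = {h} \<times> {1..n}"

definition endpoints :: "nat \<Rightarrow> point set" where
  "endpoints n = level n 0 \<union> level n 1"

text \<open>Position of an endpoint when the boundary of the rectangle is traversed counterclockwise,
  starting at the bottom left corner.\<close>

definition boundary_pos :: "nat \<Rightarrow> point \<Rightarrow> nat" where
  "boundary_pos n p = (if fst p = 0 then snd p else 2 * n + 1 - snd p)"

definition perfect_matching :: "nat \<Rightarrow> diagram \<Rightarrow> bool" where
  "perfect_matching n D \<longleftrightarrow> D \<subseteq> endpoints n \<times> endpoints n \<and> sym D \<and> irrefl D \<and>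
     (\<forall>x\<in>endpoints n. \<exists>!y. (x, y) \<in> D)"

definition noncrossing :: "nat \<Rightarrow> diagram \<Rightarrow> bool" where
  "noncrossing n D \<longleftrightarrow> (\<nexists>a b c d. (a, b) \<in> D \<and> (c, d) \<in> D \<and>
     boundary_pos n a < boundary_pos n c \<and> boundary_pos n c < boundary_pos n b \<and>
     boundary_pos n b < boundary_pos n d)"

definition planar_diagrams :: "nat \<Rightarrow> diagram set" where
  "planar_diagrams n = {D. perfect_matching n D \<and> noncrossing n D}"

definition id_diagram :: "nat \<Rightarrow> diagram" where
  "id_diagram n = (\<Union>k\<in>{1..n}. {((0, k), (1, k)), ((1, k), (0, k))})"

definition turnback_diagram :: "nat \<Rightarrow> nat \<Rightarrow> diagram" where
  "turnback_diagram n i =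
     (\<Union>k\<in>{1..n} - {i, Suc i}. {((0, k), (1, k)), ((1, k), (0, k))}) \<union>
     (\<Union>h\<in>{0, 1}. {((h, i), (h, Suc i)), ((h, Suc i), (h, i))})"

text \<open>Vertical concatenation: \<open>A\<close> occupies the heights from 0 to 1 and \<open>B\<close>, placed on top of it,
  the heights from 1 to 2. The relation \<open>same_component A B\<close> is lying on the same component of the
  resulting picture.\<close>

definition raise :: "diagram \<Rightarrow> diagram" where
  "raise B = {((Suc h, i), (Suc k, j)) | h i k j. ((h, i), (k, j)) \<in> B}"

definition same_component :: "diagram \<Rightarrow> diagram \<Rightarrow> (point \<times> point) set" where
  "same_component A B = (A \<union> raise B)\<^sup>*"

text \<open>The arcs of the concatenation; the map \<open>h \<mapsto> 2 * h\<close> sends the heights 0 and 1 of the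
  endpoints of the composite to the outer heights 0 and 2 of the stacked picture.\<close>

definition stack :: "nat \<Rightarrow> diagram \<Rightarrow> diagram \<Rightarrow> diagram" where
  "stack n A B = {((h, i), (k, j)) | h i k j.
     (h, i) \<in> endpoints n \<and> (k, j) \<in> endpoints n \<and> (h, i) \<noteq> (k, j) \<and>
     ((2 * h, i), (2 * k, j)) \<in> same_component A B}"

text \<open>The circles of the concatenation are the components which meet no outer endpoint.\<close>

definition circles :: "nat \<Rightarrow> diagram \<Rightarrow> diagram \<Rightarrow> nat" where
  "circles n A B = card {C \<in> (level n 0 \<union> level n 1 \<union> level n 2) // same_component A B. C \<subseteq> level n 1}"

section \<open>The Temperley-Lieb algebra\<close>

text \<open>An element is given by its coefficients in the basis of planar diagrams.\<close>

type_synonym tl = "diagram \<Rightarrow> ratfun"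

definition TL :: "nat \<Rightarrow> tl set" where
  "TL n = {x. \<forall>D. D \<notin> planar_diagrams n \<longrightarrow> x D = 0}"

definition tl_basis :: "diagram \<Rightarrow> tl" where
  "tl_basis D = (\<lambda>E. if E = D then 1 else 0)"

definition tl_zero :: tl where
  "tl_zero = (\<lambda>D. 0)"

definition tl_add :: "tl \<Rightarrow> tl \<Rightarrow> tl" where
  "tl_add x y = (\<lambda>D. x D + y D)"

definition tl_scale :: "ratfun \<Rightarrow> tl \<Rightarrow> tl" where
  "tl_scale c x = (\<lambda>D. c * x D)"

definition tl_mult :: "nat \<Rightarrow> tl \<Rightarrow> tl \<Rightarrow> tl" where
  "tl_mult n x y = (\<lambda>D. \<Sum>A\<in>planar_diagrams n. \<Sum>B\<in>planar_diagrams n.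
     x A * y B * ((q + inverse q) ^ circles n A B * tl_basis (stack n A B) D))"

definition tl_one :: "nat \<Rightarrow> tl" where
  "tl_one n = tl_basis (id_diagram n)"

definition tl_e :: "nat \<Rightarrow> nat \<Rightarrow> tl" where
  "tl_e n i = tl_basis (turnback_diagram n i)"

definition is_jones_wenzl :: "nat \<Rightarrow> tl \<Rightarrow> bool" where
  "is_jones_wenzl n P \<longleftrightarrow> P \<in> TL n \<and>
     (\<forall>i\<in>{1..<n}. tl_mult n P (tl_e n i) = tl_zero \<and> tl_mult n (tl_e n i) P = tl_zero) \<and>
     P (id_diagram n) = 1"

definition jones_wenzl :: "nat \<Rightarrow> tl" where
  "jones_wenzl n = (THE P. is_jones_wenzl n P)"

section \<open>Positive braids and the Kauffman bracket\<close>

text \<open>A positive braid word is the list of the indices of its generators. A semi-infinite word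
  is a sequence \<open>j\<close> whose first letter is \<open>j 0\<close>.\<close>

definition semi_infinite_positive_braid :: "nat \<Rightarrow> (nat \<Rightarrow> nat) \<Rightarrow> bool" where
  "semi_infinite_positive_braid n j \<longleftrightarrow> (\<forall>m. j m \<in> {1..<n})"

definition complete_braid :: "nat \<Rightarrow> (nat \<Rightarrow> nat) \<Rightarrow> bool" where
  "complete_braid n j \<longleftrightarrow> (\<forall>i\<in>{1..<n}. infinite {m. j m = i})"

definition partial_braid :: "(nat \<Rightarrow> nat) \<Rightarrow> nat \<Rightarrow> nat list" where
  "partial_braid j l = map j [0..<l]"

text \<open>An orientation is given at the bottom of the braid, where the word starts: \<open>up i\<close> means
  that the strand starting at the \<open>i\<close>-th point is oriented upward. The right-handed crossing
  \<open>\<sigma>\<^sub>i\<close> is positive if and only if its two strands are oriented in parallel. It exchanges the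
  strands at the positions \<open>i\<close> and \<open>i + 1\<close>.\<close>

fun crossing_signs :: "(nat \<Rightarrow> bool) \<Rightarrow> nat list \<Rightarrow> bool list" where
  "crossing_signs up [] = []"
| "crossing_signs up (i # w) =
     (up i = up (Suc i)) # crossing_signs (up \<circ> transpose i (Suc i)) w"

definition n_plus :: "(nat \<Rightarrow> bool) \<Rightarrow> nat list \<Rightarrow> nat" where
  "n_plus up w = length (filter (\<lambda>s. s) (crossing_signs up w))"

definition n_minus :: "(nat \<Rightarrow> bool) \<Rightarrow> nat list \<Rightarrow> nat" where
  "n_minus up w = length (filter (\<lambda>s. \<not> s) (crossing_signs up w))"

definition crossing_bracket :: "nat \<Rightarrow> nat \<Rightarrow> bool \<Rightarrow> tl" where
  "crossing_bracket n i positive =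
     (if positive
      then tl_add (tl_scale q (tl_one n)) (tl_scale (- (q ^ 2)) (tl_e n i))
      else tl_add (tl_scale (- (q powi (-2))) (tl_one n)) (tl_scale (q powi (-1)) (tl_e n i)))"

text \<open>Resolving every crossing locally gives the product of the local contributions.\<close>

definition kauffman_bracket :: "nat \<Rightarrow> (nat \<Rightarrow> bool) \<Rightarrow> nat list \<Rightarrow> tl" where
  "kauffman_bracket n up w =
     foldl (\<lambda>x (i, s). tl_mult n x (crossing_bracket n i s)) (tl_one n)
       (zip w (crossing_signs up w))"

definition normalized_bracket :: "nat \<Rightarrow> (nat \<Rightarrow> bool) \<Rightarrow> nat list \<Rightarrow> tl" where
  "normalized_bracket n up w =
     tl_scale ((-1) ^ n_minus up w * q powi (- (int (n_plus up w) - 2 * int (n_minus up w))))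
       (kauffman_bracket n up w)"

end

(* Right multiplication by 1 - q e_i multiplies a diagram with a cap at i on top by
   1 - q (q + 1/q) = - q^2, and it sends any other diagram D to D - q (D e_i). Every diagram
   except the identity has a cap on top. Hence a product of such operators in which every
   generator occurs raises the q-adic valuation on the elements whose coefficient of the
   identity diagram is 0, while it preserves that coefficient in general.

   Existence of the projector: such a product w has a fixed vector x, since x w - x always lies
   in the hyperplane of elements without identity component, and the contraction normalizes x to
   have identity coefficient 1. Every e_k x is again fixed by w and has no identity component, so
   it vanishes. The mirror image of x is therefore killed by every e_k from the right, hence
   fixed by w, hence equal to x.

   Convergence: the difference of the l-th normalized bracket and the projector has no identity
   component and is multiplied on the right by the crossings of the braid, so its valuation
   tends to infinity. *)

theory Submission
  imports Defs
begin

section \<open>Composition with identity and turnback diagrams\<close>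

text \<open>The limit of the brackets is a power series, whereas \<open>jones_wenzl\<close> has
  coefficients in \<open>ratfun\<close>, and a limit alone would not show that they are rational.
  Existence is therefore obtained by linear algebra over the rational functions, and power series
  enter only through valuations. The loop value \<open>q + inverse q\<close> has a pole at q = 0, so
  multiplication by e_i can lower valuations; the factor q in 1 - q e_i compensates exactly this
  pole. On the diagram side the obstacle is that \<open>stack\<close> and \<open>circles\<close> are
  defined through a transitive closure. The composites to be computed have the identity or a
  turnback as one factor, and for these the components are found explicitly: stacking a turnback is
  a local surgery on the involution that describes the matching. The turnback on top is analysed
  directly, and reflection transports the result to the bottom. Associativity takes the form that
  surgeries at the bottom and at the top commute and create the same number of circles in either
  order.\<close>

definition matching_fun :: "nat \<Rightarrow> (point \<Rightarrow> point) \<Rightarrow> bool" where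
  "matching_fun n m \<longleftrightarrow> (\<forall>x\<in>endpoints n. m x \<in> endpoints n \<and> m x \<noteq> x \<and> m (m x) = x)"

definition graph :: "nat \<Rightarrow> (point \<Rightarrow> point) \<Rightarrow> diagram" where
  "graph n m = {(x, m x) | x. x \<in> endpoints n}"

definition partner :: "diagram \<Rightarrow> point \<Rightarrow> point" where
  "partner D x = (THE y. (x, y) \<in> D)"

lemma mem_endpoints: "x \<in> endpoints n \<longleftrightarrow> (fst x = 0 \<or> fst x = 1) \<and> snd x \<in> {1..n}"
  by (cases x) (auto simp: endpoints_def level_def)

lemma matching_funD:
  assumes "matching_fun n m" "x \<in> endpoints n"
  shows "m x \<in> endpoints n" "m x \<noteq> x" "m (m x) = x"
  using assms by (auto simp: matching_fun_def)

lemma mem_graph: "(x, y) \<in> graph n m \<longleftrightarrow> x \<in> endpoints n \<and> y = m x"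
  unfolding graph_def by blast

lemma perfect_matching_graph:
  assumes "matching_fun n m"
  shows "perfect_matching n (graph n m)"
proof -
  have "graph n m \<subseteq> endpoints n \<times> endpoints n"
    using matching_funD(1)[OF assms] by (force simp: graph_def)
  moreover have "sym (graph n m)"
    using matching_funD[OF assms] by (simp add: sym_def mem_graph)
  moreover have "irrefl (graph n m)"
    using matching_funD(2)[OF assms] unfolding irrefl_def mem_graph by metis
  ultimately show ?thesis
    by (simp add: perfect_matching_def mem_graph)
qed

lemma perfect_matchingE:
  assumes "perfect_matching n D"
  obtains "matching_fun n (partner D)" "graph n (partner D) = D"
proof -
  have D: "D \<subseteq> endpoints n \<times> endpoints n" "sym D" "irrefl D"
    and ex: "\<And>x. x \<in> endpoints n \<Longrightarrow> \<exists>!y. (x, y) \<in> D"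
    using assms by (auto simp: perfect_matching_def)
  have p: "(x, partner D x) \<in> D" if "x \<in> endpoints n" for x
    unfolding partner_def using theI'[OF ex[OF that]] .
  have u: "y = partner D x" if "(x, y) \<in> D" for x y
    using that D(1) ex p by blast
  have "matching_fun n (partner D)"
    unfolding matching_fun_def
  proof (intro ballI conjI)
    fix x assume "x \<in> endpoints n"
    then have e: "(x, partner D x) \<in> D" by (rule p)
    show "partner D x \<in> endpoints n" using e D(1) by blast
    show "partner D x \<noteq> x" using e D(3) unfolding irrefl_def by metis
    show "partner D (partner D x) = x" using u[OF symD[OF D(2) e]] by simp
  qed
  moreover have "graph n (partner D) = D"
    using p u D(1) by (auto simp: graph_def)
  ultimately show thesis using that by blast
qed

lemma graph_cong: "(\<And>x. x \<in> endpoints n \<Longrightarrow> m x = m' x) \<Longrightarrow> graph n m = graph n m'"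
  by (auto simp: graph_def)

lemma finite_planar_diagrams: "finite (planar_diagrams n)"
proof (rule finite_subset)
  show "planar_diagrams n \<subseteq> Pow (endpoints n \<times> endpoints n)"
    by (auto simp: planar_diagrams_def perfect_matching_def)
  show "finite (Pow (endpoints n \<times> endpoints n))"
    by (simp add: endpoints_def level_def)
qed

text \<open>The strands at the positions in \<open>Q\<close> are fused along each of the two boundary lines. With
  \<open>Q = {}\<close> this is the identity diagram and with \<open>Q = {i, i + 1}\<close> the turnback diagram.\<close>

definition fused :: "nat \<Rightarrow> nat set \<Rightarrow> diagram" where
  "fused n Q = (\<Union>k\<in>{1..n} - Q. {((0, k), (1, k)), ((1, k), (0, k))}) \<union>
     {((h, k), (h, l)) | h k l. h \<in> {0, 1} \<and> k \<in> Q \<and> l \<in> Q \<and> k \<noteq> l}"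

lemma id_diagram_fused: "id_diagram n = fused n {}"
  by (auto simp: id_diagram_def fused_def)

lemma turnback_diagram_fused: "turnback_diagram n i = fused n {i, Suc i}"
  by (auto simp: turnback_diagram_def fused_def)

text \<open>A label which distinguishes the components of a diagram stacked below the fused strands:
  the set of the points at heights 0 and 1 on the component, or the points
  at height 2 for the component at the top.\<close>

definition fused_component :: "(point \<Rightarrow> point) \<Rightarrow> nat set \<Rightarrow> point \<Rightarrow> point set" where
  "fused_component m Q x =
     (let y = (if fst x = 2 then (1, snd x) else x); W = {1} \<times> Q \<union> m ` ({1} \<times> Q)
      in if fst x = 2 \<and> snd x \<in> Q then {2} \<times> Q else if y \<in> W then W else {y, m y})"

lemma raise_fused:
  "(x, y) \<in> raise (fused n Q) \<longleftrightarrow>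
     (\<exists>k\<in>{1..n} - Q. x = (1, k) \<and> y = (2, k) \<or> x = (2, k) \<and> y = (1, k)) \<or>
     (\<exists>h\<in>{1, 2}. \<exists>k\<in>Q. \<exists>l\<in>Q. k \<noteq> l \<and> x = (h, k) \<and> y = (h, l))"
  unfolding raise_def fused_def by (cases x; cases y) (auto simp: numeral_2_eq_2)

lemma sym_graph: "matching_fun n m \<Longrightarrow> sym (graph n m)"
  using perfect_matching_graph by (auto simp: perfect_matching_def)

section \<open>Components of a diagram stacked below fused strands\<close>

definition levels :: "nat \<Rightarrow> point set" where
  "levels n = level n 0 \<union> level n 1 \<union> level n 2"

lemma levels_iff: "x \<in> levels n \<longleftrightarrow> x \<in> endpoints n \<or> (fst x = 2 \<and> snd x \<in> {1..n})"
  by (cases x) (auto simp: levels_def endpoints_def level_def)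

lemma fused_component_inner:
  "fst x \<noteq> 2 \<Longrightarrow> fused_component m Q x =
    (if x \<in> {1} \<times> Q \<union> m ` ({1} \<times> Q) then {1} \<times> Q \<union> m ` ({1} \<times> Q) else {x, m x})"
  by (simp add: fused_component_def Let_def)

lemma fused_component_top:
  "k \<in> Q \<Longrightarrow> fused_component m Q (2, k) = {2} \<times> Q"
  "k \<notin> Q \<Longrightarrow> fused_component m Q (2, k) = fused_component m Q (1, k)"
  by (simp_all add: fused_component_def Let_def)

context
  fixes n m Q
  assumes m: "matching_fun n m" and Q: "Q \<subseteq> {1..n}"
begin

lemma fused_points: "z \<in> {1} \<times> Q \<Longrightarrow> z \<in> endpoints n"
  using Q by (force simp: mem_endpoints)

text \<open>Soundness of the label: it is constant along each arc, hence on each component. Arcs of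
  the lower diagram respect it because both \<open>W\<close> and the two-point sets are closed under
  the involution \<open>m\<close>.\<close>

lemma fused_component_edge:
  assumes "(x, y) \<in> graph n m \<union> raise (fused n Q)"
  shows "y \<in> levels n \<and> fused_component m Q y = fused_component m Q x"
proof -
  from assms consider (g) "x \<in> endpoints n" "y = m x"
    | (u) k where "k \<in> {1..n} - Q" "x = (1, k) \<and> y = (2, k) \<or> x = (2, k) \<and> y = (1, k)"
    | (f) h k l where "h \<in> {1, 2}" "k \<in> Q" "l \<in> Q" "x = (h, k)" "y = (h, l)"
    unfolding Un_iff raise_fused mem_graph by blast
  then show ?thesis
  proof cases
    case g
    let ?W = "{1} \<times> Q \<union> m ` ({1} \<times> Q)"
    have y: "y \<in> endpoints n" "m y = x" using g matching_funD[OF m] by auto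
    have W: "m z \<in> ?W" if z: "z \<in> ?W" for z
    proof (cases "z \<in> {1} \<times> Q")
      case False
      then obtain w where "w \<in> {1} \<times> Q" "z = m w" using z by blast
      with matching_funD(3)[OF m fused_points, of w] have "m z = w" by metis
      with \<open>w \<in> {1} \<times> Q\<close> show ?thesis by (metis UnI1)
    qed blast
    have "x \<in> ?W \<longleftrightarrow> y \<in> ?W"
      using W[of x] W[of y] unfolding g(2)[symmetric] y(2) by (rule iffI)
    moreover have "fst x \<noteq> 2" "fst y \<noteq> 2" using g(1) y(1) by (auto simp: mem_endpoints)
    moreover have "{x, m x} = {y, m y}" using y g by auto
    ultimately show ?thesis
      using y(1) by (simp only: fused_component_inner levels_iff if_True if_False simp_thms)
  next
    case u
    then show ?thesis
      by (elim disjE conjE) (simp_all add: fused_component_top levels_iff mem_endpoints)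
  next
    case f
    have "k \<in> {1..n}" "l \<in> {1..n}" using f Q by blast+
    with f show ?thesis
      by (elim insertE) (simp_all add: fused_component_top fused_component_inner levels_iff mem_endpoints)
  qed
qed

lemma same_component_fused_imp:
  assumes "(x, y) \<in> same_component (graph n m) (fused n Q)" "x \<in> levels n"
  shows "y \<in> levels n \<and> fused_component m Q y = fused_component m Q x"
  using assms(1) unfolding same_component_def
proof (induction rule: rtrancl_induct)
  case base
  then show ?case using assms(2) by simp
next
  case (step y z)
  then show ?case using fused_component_edge[OF step.hyps(2)] by simp
qed

text \<open>Completeness of the label: every point that it lists can be reached. From a point at
  height 2 outside \<open>Q\<close> the path first descends along the vertical strand to height
  1.\<close>

lemma same_component_fused_mem:
  assumes "x \<in> levels n" "z \<in> fused_component m Q x"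
  shows "(x, z) \<in> same_component (graph n m) (fused n Q)"
proof -
  let ?S = "same_component (graph n m) (fused n Q)"
  have e: "(u, v) \<in> ?S" if "(u, v) \<in> graph n m \<union> raise (fused n Q)" for u v
    using that unfolding same_component_def by blast
  have t: "(u, w) \<in> ?S" if "(u, v) \<in> ?S" "(v, w) \<in> ?S" for u v w
    using that unfolding same_component_def by (rule rtrancl_trans)
  have r: "(u, u) \<in> ?S" for u
    unfolding same_component_def by simp
  have f: "((h, k), (h, l)) \<in> ?S" if "h \<in> {1, 2}" "k \<in> Q" "l \<in> Q" for h k l
    using that r by (cases "k = l") (auto intro!: e simp: raise_fused)
  have g: "(u, m u) \<in> ?S" "(m u, u) \<in> ?S" if "u \<in> endpoints n" for u
    using that matching_funD[OF m that] by (simp_all add: e mem_graph)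
  define y where "y = (if fst x = 2 then (1, snd x) else x)"
  define W where "W = {1} \<times> Q \<union> m ` ({1} \<times> Q)"
  show ?thesis
  proof (cases "fst x = 2 \<and> snd x \<in> Q")
    case True
    then show ?thesis
      using assms(2) f[of 2 "snd x"] by (cases x) (auto simp: fused_component_def)
  next
    case False
    have y: "y \<in> endpoints n \<and> (x, y) \<in> ?S"
    proof (cases "fst x = 2")
      case two: True
      then obtain k where k: "x = (2, k)" "k \<in> {1..n} - Q"
        using assms(1) False by (cases x) (auto simp: levels_iff mem_endpoints)
      then have "(x, (1, k)) \<in> raise (fused n Q)"
        unfolding raise_fused by blast
      with k show ?thesis by (simp add: e y_def mem_endpoints)
    next
      case False
      then show ?thesis
        using assms(1) r by (simp add: y_def levels_iff)
    qed
    have fc: "fused_component m Q x = (if y \<in> W then W else {y, m y})"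
      using False unfolding fused_component_def W_def y_def Let_def by (simp only: if_False)
    have "(y, z) \<in> ?S"
    proof (cases "y \<in> W")
      case True
      have c: "\<exists>k\<in>Q. (u, (1, k)) \<in> ?S \<and> ((1, k), u) \<in> ?S" if "u \<in> W" for u
      proof -
        from that consider k where "k \<in> Q" "u = (1, k)" | k where "k \<in> Q" "u = m (1, k)"
          unfolding W_def by blast
        then show ?thesis
          using r g[OF fused_points] by cases (blast, metis mem_Sigma_iff singletonI)
      qed
      have "z \<in> W"
        using assms(2) True fc by simp
      with c[OF this] c[OF True] f[of 1] show ?thesis
        by (meson insertI1 t)
    next
      case not: False
      then have "z \<in> {y, m y}"
        using assms(2) fc by simp
      then show ?thesis using r[of y] g[of y] y by (metis insertE singletonD)
    qed
    with y show ?thesis using t by blast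
  qed
qed

lemma same_component_fused:
  assumes "x \<in> levels n" "y \<in> levels n"
  shows "(x, y) \<in> same_component (graph n m) (fused n Q) \<longleftrightarrow>
    fused_component m Q x = fused_component m Q y"
proof
  let ?S = "same_component (graph n m) (fused n Q)"
  assume eq: "fused_component m Q x = fused_component m Q y"
  \<comment> \<open>A point of the common label from which \<open>y\<close> is reached:
    \<open>y\<close> itself, or the point directly below it when the label mentions only heights 0
    and 1.\<close>
  have "\<exists>z \<in> fused_component m Q y. (z, y) \<in> ?S"
  proof (cases "fst y = 2 \<and> snd y \<notin> Q")
    case True
    then have "((1, snd y), y) \<in> ?S"
      using assms(2) unfolding same_component_def
      by (cases y) (auto simp: raise_fused levels_iff mem_endpoints)
    moreover have "(1, snd y) \<in> fused_component m Q y"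
      using True by (auto simp: fused_component_def Let_def)
    ultimately show ?thesis by blast
  next
    case False
    have "(y, y) \<in> ?S" unfolding same_component_def by simp
    moreover have "y \<in> fused_component m Q y"
      using False by (cases y) (auto simp: fused_component_def Let_def)
    ultimately show ?thesis by blast
  qed
  then show "(x, y) \<in> ?S"
    using same_component_fused_mem[OF assms(1)] eq
    unfolding same_component_def by (metis rtrancl_trans)
qed (use same_component_fused_imp assms in auto)

lemma mem_stack_fused:
  assumes "x \<in> endpoints n" "y \<in> endpoints n"
  shows "(x, y) \<in> stack n (graph n m) (fused n Q) \<longleftrightarrow> x \<noteq> y \<and>
    fused_component m Q (2 * fst x, snd x) = fused_component m Q (2 * fst y, snd y)"
proof -
  have "(2 * fst x, snd x) \<in> levels n" "(2 * fst y, snd y) \<in> levels n"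
    using assms by (auto simp: levels_iff mem_endpoints)
  from same_component_fused[OF this] show ?thesis
    using assms unfolding stack_def by (cases x; cases y) auto
qed

lemma fused_component_outer:
  assumes "x \<in> endpoints n"
  shows "fused_component m Q (2 * fst x, snd x) =
    (if x \<in> {1} \<times> Q then {2} \<times> Q else if x \<in> m ` ({1} \<times> Q) then {1} \<times> Q \<union> m ` ({1} \<times> Q)
     else {x, m x})"
  using assms by (cases x) (auto simp: fused_component_def mem_endpoints Let_def)

end

text \<open>The surgery caused by a turnback at the neighbours \<open>a\<close> and
  \<open>b\<close>: their former partners become joined, and so do \<open>a\<close> and
  \<open>b\<close>. The updates at \<open>a\<close> and \<open>b\<close> come last and prevail, so a
  matching that already joins \<open>a\<close> to \<open>b\<close> is left unchanged.\<close>

definition turn :: "'a \<Rightarrow> 'a \<Rightarrow> ('a \<Rightarrow> 'a) \<Rightarrow> 'a \<Rightarrow> 'a" where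
  "turn a b m = m(m a := m b, m b := m a, a := b, b := a)"

lemma stack_eq_graphI:
  assumes "\<And>x y. x \<in> endpoints n \<Longrightarrow> y \<in> endpoints n \<Longrightarrow> (x, y) \<in> stack n A B \<longleftrightarrow> y = f x"
    and "\<And>x. x \<in> endpoints n \<Longrightarrow> f x \<in> endpoints n"
  shows "stack n A B = graph n f"
proof -
  have "stack n A B \<subseteq> endpoints n \<times> endpoints n" by (auto simp: stack_def)
  then have "(x, y) \<in> stack n A B \<longleftrightarrow> (x, y) \<in> graph n f" for x y
    using assms(1)[of x y] assms(2)[of x] unfolding mem_graph by blast
  then show ?thesis by (intro set_eqI) (metis surj_pair)
qed

lemma stack_id_diagram:
  assumes "matching_fun n m"
  shows "stack n (graph n m) (id_diagram n) = graph n m"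
proof -
  have "(x, y) \<in> stack n (graph n m) (fused n {}) \<longleftrightarrow> y = m x"
    if "x \<in> endpoints n" "y \<in> endpoints n" for x y
    using that mem_stack_fused[OF assms, of "{}" x y] fused_component_outer[OF assms, of "{}" x]
      fused_component_outer[OF assms, of "{}" y]
      matching_funD[OF assms that(1)] matching_funD[OF assms that(2)]
    by (simp add: doubleton_eq_iff) metis
  with matching_funD(1)[OF assms] show ?thesis
    unfolding id_diagram_fused by (intro stack_eq_graphI)
qed

text \<open>The right-hand side has the shape of the case distinction in
  \<open>fused_component_outer\<close>: both points on the new cap, both among the former partners,
  or both on an untouched arc. In this form the surgery can be compared with equality of
  labels.\<close>

lemma eq_turn_iff:
  assumes "a \<noteq> b" "m a \<noteq> a" "m (m a) = a" "m b \<noteq> b" "m (m b) = b" "m x \<noteq> x" "m (m x) = x"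
  shows "y = turn a b m x \<longleftrightarrow> x \<noteq> y \<and>
      (x \<in> {a, b} \<and> y \<in> {a, b} \<or> x \<notin> {a, b} \<and> y \<notin> {a, b} \<and>
        (x \<in> {m a, m b} \<and> y \<in> {m a, m b} \<or>
         x \<notin> {m a, m b} \<and> y \<notin> {m a, m b} \<and> (y = x \<or> y = m x)))"
proof -
  have ne: "m a \<noteq> m b" using assms(1,3,5) by metis
  consider "x = a" | "x = b" | "x = m a" "x \<notin> {a, b}" | "x = m b" "x \<notin> {a, b}"
    | "x \<notin> {a, b}" "x \<notin> {m a, m b}"
    by blast
  then show ?thesis
  proof cases
    case 1
    then have "turn a b m x = b" by (simp add: turn_def)
    then show ?thesis using 1 assms(1) by auto
  next
    case 2
    then have "turn a b m x = a" using assms(1) by (simp add: turn_def)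
    then show ?thesis using 2 assms(1) by auto
  next
    case 3
    then have t: "turn a b m x = m b" using ne by (simp add: turn_def)
    have "m b \<notin> {a, b}" using 3 assms(4,5) by auto
    moreover have x: "x \<in> {m a, m b}" "x \<noteq> m b" using 3 ne by simp_all
    ultimately have "y = m b \<longleftrightarrow> x \<noteq> y \<and> y \<notin> {a, b} \<and> y \<in> {m a, m b}" using 3(1) by auto
    with x show ?thesis unfolding t using 3(2) by blast
  next
    case 4
    then have t: "turn a b m x = m a" using ne by (simp add: turn_def)
    have "m a \<notin> {a, b}" using 4 assms(2,3) by auto
    moreover have x: "x \<in> {m a, m b}" "x \<noteq> m a" using 4 ne by simp_all
    ultimately have "y = m a \<longleftrightarrow> x \<noteq> y \<and> y \<notin> {a, b} \<and> y \<in> {m a, m b}" using 4(1) by auto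
    with x show ?thesis unfolding t using 4(2) by blast
  next
    case 5
    then have t: "turn a b m x = m x" by (simp add: turn_def)
    have "m x \<notin> {a, b}" "m x \<notin> {m a, m b}" using 5 assms by (metis empty_iff insert_iff)+
    with 5 assms(6) show ?thesis unfolding t by metis
  qed
qed

lemma stack_turnback_diagram:
  assumes m: "matching_fun n m" and i: "i \<in> {1..<n}"
  shows "stack n (graph n m) (turnback_diagram n i) = graph n (turn (1, i) (1, Suc i) m)"
proof -
  let ?a = "(1, i) :: point" and ?b = "(1, Suc i) :: point"
  let ?Q = "{i, Suc i}"
  have Q: "?Q \<subseteq> {1..n}" using i by auto
  have Q1: "{1} \<times> ?Q = {?a, ?b}" by auto
  have ab: "?a \<in> endpoints n" "?b \<in> endpoints n" "?a \<noteq> ?b" using i by (auto simp: mem_endpoints)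
  have "(x, y) \<in> stack n (graph n m) (fused n ?Q) \<longleftrightarrow> y = turn ?a ?b m x"
    if xy: "x \<in> endpoints n" "y \<in> endpoints n" for x y
  proof -
    \<comment> \<open>The point \<open>(2, i)\<close> is not an endpoint of the lower diagram, so
      the label at the top differs from all labels formed at heights 0 and 1.\<close>
    have two: "(2::nat, i) \<notin> {x, y, m x, m y, ?a, ?b, m ?a, m ?b}"
    proof -
      have "(2, i) \<notin> endpoints n" by (simp add: mem_endpoints)
      then show ?thesis
        using xy ab matching_funD(1)[OF m xy(1)] matching_funD(1)[OF m xy(2)]
          matching_funD(1)[OF m ab(1)] matching_funD(1)[OF m ab(2)] by (metis insertE emptyE)
    qed
    let ?T = "{2} \<times> ?Q" and ?W = "{1} \<times> ?Q \<union> m ` ({1} \<times> ?Q)"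
    have mab: "m ` {?a, ?b} = {m ?a, m ?b}" by auto
    have T: "?T \<noteq> ?W" "?T \<noteq> {x, m x}" "?T \<noteq> {y, m y}"
      using two by (blast, blast, blast)
    have W: "?W \<noteq> {z, m z}" if "z \<notin> m ` ({1} \<times> ?Q)" "z \<notin> {1} \<times> ?Q" for z
      using that by blast
    have eq: "{x, m x} = {y, m y} \<longleftrightarrow> y = x \<or> y = m x"
      using matching_funD(3)[OF m xy(1)] matching_funD(3)[OF m xy(2)] by (auto simp: doubleton_eq_iff)
    define A B T W where defs: "A = {1::nat} \<times> ?Q" "B = m ` ({1} \<times> ?Q)" "T = {2::nat} \<times> ?Q"
      "W = {1} \<times> ?Q \<union> m ` ({1} \<times> ?Q)"
    have "(x, y) \<in> stack n (graph n m) (fused n ?Q) \<longleftrightarrow> x \<noteq> y \<and>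
      (if x \<in> A then T else if x \<in> B then W else {x, m x}) =
      (if y \<in> A then T else if y \<in> B then W else {y, m y})"
      unfolding mem_stack_fused[OF m Q xy] fused_component_outer[OF m Q xy(1)]
        fused_component_outer[OF m Q xy(2)] defs ..
    also have "\<dots> \<longleftrightarrow> x \<noteq> y \<and>
      (x \<in> A \<and> y \<in> A \<or> x \<notin> A \<and> y \<notin> A \<and>
        (x \<in> B \<and> y \<in> B \<or> x \<notin> B \<and> y \<notin> B \<and> (y = x \<or> y = m x)))"
      using T[folded defs] W[of x, folded defs] W[of y, folded defs] eq
      by (cases "x \<in> A"; cases "x \<in> B"; cases "y \<in> A"; cases "y \<in> B")
        (simp_all only: if_True if_False simp_thms not_False_eq_True not_True_eq_False, metis+)
    finally have "(x, y) \<in> stack n (graph n m) (fused n ?Q) \<longleftrightarrow> x \<noteq> y \<and>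
      (x \<in> {?a, ?b} \<and> y \<in> {?a, ?b} \<or> x \<notin> {?a, ?b} \<and> y \<notin> {?a, ?b} \<and>
        (x \<in> {m ?a, m ?b} \<and> y \<in> {m ?a, m ?b} \<or>
         x \<notin> {m ?a, m ?b} \<and> y \<notin> {m ?a, m ?b} \<and> (y = x \<or> y = m x)))"
      unfolding defs Q1 mab .
    also have "\<dots> \<longleftrightarrow> y = turn ?a ?b m x"
      using ab matching_funD[OF m xy(1)] matching_funD[OF m ab(1)] matching_funD[OF m ab(2)]
      by (intro eq_turn_iff[symmetric]) simp_all
    finally show ?thesis .
  qed
  moreover have "turn ?a ?b m x \<in> endpoints n" if "x \<in> endpoints n" for x
    using that ab matching_funD(1)[OF m that] matching_funD(1)[OF m ab(1)] matching_funD(1)[OF m ab(2)]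
    by (simp add: turn_def)
  ultimately show ?thesis
    unfolding turnback_diagram_fused by (intro stack_eq_graphI)
qed

section \<open>Circles in the composite\<close>

context
  fixes n m Q
  assumes m: "matching_fun n m" and Q: "Q \<subseteq> {1..n}"
begin

lemma fused_class:
  assumes "x \<in> levels n"
  shows "same_component (graph n m) (fused n Q) `` {x} =
    {y \<in> levels n. fused_component m Q y = fused_component m Q x}"
  using same_component_fused[OF m Q assms] same_component_fused_imp[OF m Q _ assms]
  by (auto simp: Image_singleton_iff)

text \<open>A point at height 1 outside \<open>Q\<close> continues straight up to height 2, so a
  component confined to the middle line must pass through a position in \<open>Q\<close>.\<close>

lemma fused_class_inner:
  assumes "C \<in> levels n // same_component (graph n m) (fused n Q)" "C \<subseteq> level n 1"
  obtains k where "k \<in> Q" "C = same_component (graph n m) (fused n Q) `` {(1, k)}"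
proof -
  let ?S = "same_component (graph n m) (fused n Q)"
  obtain x where x: "x \<in> levels n" "C = ?S `` {x}"
    using assms(1) by (elim quotientE)
  have xC: "x \<in> C" unfolding x(2) same_component_def by blast
  then obtain k where k: "x = (1, k)" "k \<in> {1..n}" using assms(2) by (force simp: level_def)
  have "k \<in> Q"
  proof (rule ccontr)
    assume "k \<notin> Q"
    with k have "(x, (2, k)) \<in> raise (fused n Q)" unfolding raise_fused by blast
    then have "(2, k) \<in> C" unfolding x(2) same_component_def by blast
    with assms(2) show False by (auto simp: level_def)
  qed
  with k x that show thesis by blast
qed

end

lemma circles_id_diagram:
  assumes "matching_fun n m"
  shows "circles n (graph n m) (id_diagram n) = 0"
proof -
  have "{C \<in> levels n // same_component (graph n m) (fused n {}). C \<subseteq> level n 1} = {}"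
    using fused_class_inner[OF assms, of "{}"] by blast
  then show ?thesis
    unfolding circles_def id_diagram_fused levels_def[symmetric] by (simp only: card.empty)
qed

text \<open>Both positions of the turnback lie on one component, which is the only candidate for a
  circle. It is closed when the lower diagram joins these positions; otherwise the arc from
  \<open>(1, i)\<close> leads to an endpoint at height 0 or to a strand going up.\<close>

lemma circles_turnback_diagram:
  assumes m: "matching_fun n m" and i: "i \<in> {1..<n}"
  shows "circles n (graph n m) (turnback_diagram n i) = (if m (1, i) = (1, Suc i) then 1 else 0)"
proof -
  let ?a = "(1, i) :: point" and ?b = "(1, Suc i) :: point"
  let ?Q = "{i, Suc i}"
  let ?S = "same_component (graph n m) (fused n ?Q)"
  let ?C = "?S `` {?a}"
  have Q: "?Q \<subseteq> {1..n}" using i by auto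
  have ab: "?a \<in> endpoints n" "?b \<in> endpoints n" using i by (auto simp: mem_endpoints)
  have abl: "?a \<in> levels n" "?b \<in> levels n" using ab unfolding levels_iff by blast+
  define W where "W = {1} \<times> ?Q \<union> m ` ({1} \<times> ?Q)"
  have W: "W = {?a, ?b, m ?a, m ?b}" unfolding W_def by auto
  have inner: "fused_component m ?Q y = (if y \<in> W then W else {y, m y})" if "fst y \<noteq> 2" for y
    unfolding W_def by (rule fused_component_inner[OF that])
  have ca: "fused_component m ?Q ?a = W" "fused_component m ?Q ?b = W"
    by (simp_all add: inner W)
  have C: "?C = {y \<in> levels n. fused_component m ?Q y = W}" "?S `` {?b} = ?C"
    using fused_class[OF m Q abl(1)] fused_class[OF m Q abl(2)] ca by simp_all
  have e: "(u, v) \<in> ?S" if "(u, v) \<in> raise (fused n ?Q)" for u v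
    using that unfolding same_component_def by blast
  have "?C \<subseteq> level n 1 \<longleftrightarrow> m ?a = ?b"
  proof
    assume sub: "?C \<subseteq> level n 1"
    show "m ?a = ?b"
    proof (rule ccontr)
      assume ne: "m ?a \<noteq> ?b"
      have "(?a, m ?a) \<in> ?S" unfolding same_component_def using ab by (auto simp: mem_graph)
      then have "m ?a \<in> ?C" by blast
      then obtain k where k: "m ?a = (1, k)" "k \<in> {1..n}"
        using sub by (force simp: level_def)
      have "k \<notin> ?Q" using k ne matching_funD(2)[OF m ab(1)] by auto
      then have "(m ?a, (2, k)) \<in> ?S"
        using k by (intro e) (simp add: raise_fused)
      with \<open>(?a, m ?a) \<in> ?S\<close> have "(?a, (2, k)) \<in> ?S"
        unfolding same_component_def by (rule rtrancl_trans)
      then have "(2, k) \<in> ?C" by blast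
      with sub show False by (auto simp: level_def)
    qed
  next
    assume mab: "m ?a = ?b"
    then have "m ?b = ?a" using matching_funD(3)[OF m ab(1)] by simp
    with mab W have W2: "W = {?a, ?b}" by auto
    show "?C \<subseteq> level n 1"
    proof
      fix y assume "y \<in> ?C"
      then have y: "fused_component m ?Q y = W" unfolding C(1) by blast
      have "y \<in> W"
      proof (cases "fst y = 2")
        case True
        then obtain k where k: "y = (2, k)" by (cases y) auto
        show ?thesis
        proof (cases "k \<in> ?Q")
          case True
          from fused_component_top(1)[OF this, of m] y have "W = {2} \<times> ?Q"
            unfolding k by (rule trans[OF sym, rotated])
          then have "?a \<in> {2} \<times> ?Q" using W2 by blast
          then show ?thesis by simp
        next
          case False
          from fused_component_top(2)[OF this, of m] y have "fused_component m ?Q (1, k) = W"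
            unfolding k by (rule trans[OF sym])
          moreover have "fst (1, k) \<noteq> (2 :: nat)" by simp
          ultimately have "(1, k) \<in> W" using inner by (metis insertI1)
          then show ?thesis using W2 False by auto
        qed
      next
        case False
        then show ?thesis using y inner by (metis insertI1)
      qed
      then show "y \<in> level n 1" using W2 i by (auto simp: level_def)
    qed
  qed
  moreover have "{C \<in> levels n // ?S. C \<subseteq> level n 1} = (if ?C \<subseteq> level n 1 then {?C} else {})"
  proof -
    have gen: "{C \<in> A. P C} = (if P C0 then {C0} else {})"
      if "\<And>C. C \<in> A \<Longrightarrow> P C \<Longrightarrow> C = C0" "C0 \<in> A" for A P and C0 :: "point set"
    proof (cases "P C0")
      case True
      then have "{C \<in> A. P C} = {C0}" using that by blast
      with True show ?thesis by simp
    next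
      case False
      then have "{C \<in> A. P C} = {}" using that by blast
      with False show ?thesis by simp
    qed
    show ?thesis
    proof (rule gen)
      fix C assume "C \<in> levels n // ?S" "C \<subseteq> level n 1"
      from fused_class_inner[OF m Q this] obtain k where k: "k \<in> ?Q" "C = ?S `` {(1, k)}" .
      from k(1) consider "k = i" | "k = Suc i" by blast
      then show "C = ?C"
        by cases (simp_all only: k(2) C(2))
    qed (rule quotientI[OF abl(1)])
  qed
  ultimately show ?thesis
    unfolding circles_def turnback_diagram_fused levels_def[symmetric] by simp
qed

section \<open>Planarity\<close>

text \<open>Involutivity is read off from \<open>eq_turn_iff\<close>, whose right-hand side is
  symmetric in \<open>x\<close> and \<open>y\<close> for an involution \<open>m\<close>.\<close>

lemma matching_fun_turn:
  assumes m: "matching_fun n m" and ab: "a \<in> endpoints n" "b \<in> endpoints n" "a \<noteq> b"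
  shows "matching_fun n (turn a b m)"
proof -
  have "turn a b m x \<in> endpoints n \<and> turn a b m x \<noteq> x \<and> turn a b m (turn a b m x) = x"
    if x: "x \<in> endpoints n" for x
  proof -
    note f = matching_funD[OF m x] matching_funD[OF m ab(1)] matching_funD[OF m ab(2)]
    have fr: "turn a b m x \<in> endpoints n" using f ab by (simp add: turn_def)
    note g = matching_funD[OF m fr]
    have eq: "y = turn a b m z \<longleftrightarrow> z \<noteq> y \<and>
      (z \<in> {a, b} \<and> y \<in> {a, b} \<or> z \<notin> {a, b} \<and> y \<notin> {a, b} \<and>
        (z \<in> {m a, m b} \<and> y \<in> {m a, m b} \<or>
         z \<notin> {m a, m b} \<and> y \<notin> {m a, m b} \<and> (y = z \<or> y = m z)))"
      if "z \<in> endpoints n" for y z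
      using f ab(3) matching_funD[OF m that] by (intro eq_turn_iff)
    have "turn a b m x \<noteq> x" using eq[OF x, of "turn a b m x"] by metis
    moreover have "x = turn a b m (turn a b m x)"
      using eq[OF x, of "turn a b m x"] eq[OF fr, of x] f(3) g(3) by metis
    ultimately show ?thesis using fr by metis
  qed
  then show ?thesis unfolding matching_fun_def by blast
qed

lemma turn_id: "m a = b \<Longrightarrow> m b = a \<Longrightarrow> turn a b m = m"
  by (auto simp: turn_def)

lemma turn_cap: "a \<noteq> b \<Longrightarrow> turn a b m a = b" "turn a b m b = a"
  by (simp_all add: turn_def)

text \<open>The combinatorial core of associativity, with \<open>a\<close>, \<open>b\<close> at the
  bottom and \<open>c\<close>, \<open>d\<close> at the top. Although the two pairs are disjoint,
  \<open>m\<close> may join points of one to points of the other, which is why the surgeries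
  interact and all coincidences among partners are examined.\<close>

lemma turn_commute:
  assumes "distinct [a, b, c, d]" "m (m a) = a" "m (m b) = b" "m (m c) = c" "m (m d) = d"
    "m a \<noteq> a" "m b \<noteq> b" "m c \<noteq> c" "m d \<noteq> d" "m (m x) = x"
  shows "turn a b (turn c d m) x = turn c d (turn a b m) x"
proof -
  have ne: "a \<noteq> b" "a \<noteq> c" "a \<noteq> d" "b \<noteq> c" "b \<noteq> d" "c \<noteq> d" using assms(1) by auto
  have ne': "m a \<noteq> m b" "m a \<noteq> m c" "m a \<noteq> m d" "m b \<noteq> m c" "m b \<noteq> m d" "m c \<noteq> m d"
    using ne assms(2-5) by metis+
  have "m u = v \<longleftrightarrow> m v = u" if "m (m u) = u" "m (m v) = v" for u v
    using that by metis
  then have s: "m c = a \<longleftrightarrow> m a = c" "m c = b \<longleftrightarrow> m b = c" "m d = a \<longleftrightarrow> m a = d" "m d = b \<longleftrightarrow> m b = d"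
    "m b = a \<longleftrightarrow> m a = b" "m d = c \<longleftrightarrow> m c = d"
    "m x = a \<longleftrightarrow> m a = x" "m x = b \<longleftrightarrow> m b = x" "m x = c \<longleftrightarrow> m c = x" "m x = d \<longleftrightarrow> m d = x"
    using assms(2-5,10) by blast+
  show ?thesis
    using ne ne' s assms(6-9) unfolding turn_def fun_upd_def by (smt (verit))
qed

text \<open>When \<open>m\<close> joins the pair \<open>a\<close>, \<open>b\<close> to the pair
  \<open>c\<close>, \<open>d\<close>, the first surgery closes no circle and the second one does, in
  either order. In all other cases the two surgeries close circles independently of each
  other.\<close>

lemma turn_commute_caps:
  assumes "distinct [a, b, c, d]" "m (m a) = a" "m (m b) = b" "m (m c) = c" "m (m d) = d"
    "m a \<noteq> a" "m b \<noteq> b" "m c \<noteq> c" "m d \<noteq> d"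
  shows "(if m a = b then 1 else 0) + (if turn a b m c = d then 1 else 0 :: nat) =
    (if m c = d then 1 else 0) + (if turn c d m a = b then 1 else 0)"
proof -
  have ne: "a \<noteq> b" "a \<noteq> c" "a \<noteq> d" "b \<noteq> c" "b \<noteq> d" "c \<noteq> d" using assms(1) by auto
  have "m u = v \<longleftrightarrow> m v = u" if "m (m u) = u" "m (m v) = v" for u v
    using that by metis
  then have s: "m c = a \<longleftrightarrow> m a = c" "m c = b \<longleftrightarrow> m b = c" "m d = a \<longleftrightarrow> m a = d" "m d = b \<longleftrightarrow> m b = d"
    using assms(2-5) by blast+
  have "turn a b m c = d \<longleftrightarrow> m c = d \<or> m a = c \<and> m b = d \<or> m b = c \<and> m a = d"
    using ne s assms(2,3) unfolding turn_def fun_upd_def by (simp split: if_split) metis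
  moreover have "turn c d m a = b \<longleftrightarrow> m a = b \<or> m c = a \<and> m d = b \<or> m d = a \<and> m c = b"
    using ne s assms(4,5) unfolding turn_def fun_upd_def by (simp split: if_split) metis
  ultimately show ?thesis using ne s by (simp split: if_split) metis
qed

text \<open>Two arcs with disjoint pairs of ends cross when exactly one end of the second arc lies
  between the ends of the first one.\<close>

definition crossed :: "nat \<Rightarrow> nat \<Rightarrow> nat \<Rightarrow> nat \<Rightarrow> bool" where
  "crossed x y z w \<longleftrightarrow> ((x < z) \<noteq> (y < z)) \<noteq> ((x < w) \<noteq> (y < w))"

text \<open>These are the eight of the 24 orders of four points in which the two pairs interleave.
  They turn the parity condition into the ordered patterns used by
  \<open>noncrossing\<close>.\<close>

lemma crossed_cases:
  assumes "crossed x y z w" "z \<noteq> x" "z \<noteq> y" "w \<noteq> x" "w \<noteq> y"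
  shows "(x < z \<and> z < y \<and> y < w) \<or> (y < z \<and> z < x \<and> x < w) \<or> (x < w \<and> w < y \<and> y < z) \<or>
    (y < w \<and> w < x \<and> x < z) \<or> (z < x \<and> x < w \<and> w < y) \<or> (z < y \<and> y < w \<and> w < x) \<or>
    (w < x \<and> x < z \<and> z < y) \<or> (w < y \<and> y < z \<and> z < x)"
proof -
  have "\<not> x < z \<longleftrightarrow> z < x" "\<not> y < z \<longleftrightarrow> z < y" "\<not> x < w \<longleftrightarrow> w < x" "\<not> y < w \<longleftrightarrow> w < y"
    using assms(2-5) by auto
  with assms(1) show ?thesis unfolding crossed_def by argo
qed

lemma boundary_pos_inj:
  assumes "x \<in> endpoints n" "y \<in> endpoints n" "boundary_pos n x = boundary_pos n y"
  shows "x = y"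
  using assms by (cases x; cases y) (auto simp: mem_endpoints boundary_pos_def split: if_splits)

text \<open>The definition of \<open>noncrossing\<close> names a single interleaving pattern. The
  other seven arise from it by exchanging the two arcs or the ends of an arc, and the graph of an
  involution contains every arc in both directions.\<close>

lemma noncrossing_graph:
  assumes m: "matching_fun n m"
  shows "noncrossing n (graph n m) \<longleftrightarrow> (\<forall>x\<in>endpoints n. \<forall>z\<in>endpoints n. z \<noteq> x \<longrightarrow> z \<noteq> m x \<longrightarrow>
    \<not> crossed (boundary_pos n x) (boundary_pos n (m x)) (boundary_pos n z) (boundary_pos n (m z)))"
  (is "?L \<longleftrightarrow> ?R")
proof
  let ?p = "boundary_pos n"
  assume L: ?L
  have nc: "\<not> (?p x < ?p z \<and> ?p z < ?p (m x) \<and> ?p (m x) < ?p (m z))"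
    if "x \<in> endpoints n" "z \<in> endpoints n" for x z
    using L that unfolding noncrossing_def mem_graph by blast
  show ?R
  proof (intro ballI impI)
    fix x z assume x: "x \<in> endpoints n" and z: "z \<in> endpoints n" and ne: "z \<noteq> x" "z \<noteq> m x"
    note fx = matching_funD[OF m x] and fz = matching_funD[OF m z]
    have ne2: "m z \<noteq> x" "m z \<noteq> m x" using ne fx fz by metis+
    have "?p z \<noteq> ?p x" "?p z \<noteq> ?p (m x)" "?p (m z) \<noteq> ?p x" "?p (m z) \<noteq> ?p (m x)"
      using ne ne2 boundary_pos_inj x z fx(1) fz(1) by metis+
    then show "\<not> crossed (?p x) (?p (m x)) (?p z) (?p (m z))"
      using nc[OF x z] nc[OF z x] nc[OF x fz(1)] nc[OF fz(1) x] nc[OF fx(1) z] nc[OF z fx(1)]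
        nc[OF fx(1) fz(1)] nc[OF fz(1) fx(1)] fx(3) fz(3)
        crossed_cases[of "?p x" "?p (m x)" "?p z" "?p (m z)"]
      by metis
  qed
next
  let ?p = "boundary_pos n"
  assume R: ?R
  have "\<not> (?p x < ?p z \<and> ?p z < ?p (m x) \<and> ?p (m x) < ?p (m z))"
    if "x \<in> endpoints n" "z \<in> endpoints n" for x z
  proof
    assume lt: "?p x < ?p z \<and> ?p z < ?p (m x) \<and> ?p (m x) < ?p (m z)"
    then have "z \<noteq> x" "z \<noteq> m x" by auto
    with R that have "\<not> crossed (?p x) (?p (m x)) (?p z) (?p (m z))" by blast
    with lt show False by (auto simp: crossed_def)
  qed
  then show ?L unfolding noncrossing_def mem_graph by blast
qed

text \<open>For fixed \<open>z\<close> and \<open>w\<close>, crossing is a parity that adds up along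
  the path \<open>a'\<close>, \<open>a\<close>, \<open>b\<close>, \<open>b'\<close>. The middle
  piece contributes nothing, because no position lies strictly between the neighbours
  \<open>b\<close> and \<open>a\<close>.\<close>

lemma crossed_surgery:
  assumes "a = Suc b" "z \<noteq> a" "z \<noteq> b" "w \<noteq> a" "w \<noteq> b" "crossed a' b' z w"
  shows "crossed a a' z w \<or> crossed b b' z w"
proof -
  have "a < z \<longleftrightarrow> b < z" "a < w \<longleftrightarrow> b < w" using assms by auto
  with assms(6) show ?thesis unfolding crossed_def by blast
qed

lemma not_crossed_consecutive:
  assumes "z \<notin> {x, Suc x}" "w \<notin> {x, Suc x}"
  shows "\<not> crossed (Suc x) x z w" "\<not> crossed x (Suc x) z w"
  using assms by (auto simp: crossed_def)

lemma crossed_sym: "z \<notin> {x, y} \<Longrightarrow> w \<notin> {x, y} \<Longrightarrow> crossed x y z w \<longleftrightarrow> crossed z w x y"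
  unfolding crossed_def by (cases "x < z"; cases "y < z"; cases "x < w"; cases "y < w") auto

lemma crossed_swap: "crossed x y z w \<longleftrightarrow> crossed y x z w" "crossed x y z w \<longleftrightarrow> crossed x y w z"
  by (auto simp: crossed_def)

text \<open>The boundary is traversed from right to left along the top line; the hypothesis on
  positions thus fits \<open>a = (1, i)\<close> and \<open>b = (1, Suc i)\<close>. A short arc
  between neighbours crosses nothing, and an arc crossing the new long one would cross one of the
  two old arcs.\<close>

lemma noncrossing_turn:
  assumes m: "matching_fun n m" and nc: "noncrossing n (graph n m)"
    and ab: "a \<in> endpoints n" "b \<in> endpoints n" "boundary_pos n a = Suc (boundary_pos n b)"
  shows "noncrossing n (graph n (turn a b m))"
proof -
  let ?p = "boundary_pos n" and ?t = "turn a b m"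
  have ne: "a \<noteq> b" using ab(3) by auto
  note t = matching_fun_turn[OF m ab(1,2) ne]
  have inj: "?p x \<noteq> ?p y" if "x \<noteq> y" "x \<in> endpoints n" "y \<in> endpoints n" for x y
    using that boundary_pos_inj by blast
  have nc': "\<not> crossed (?p x) (?p (m x)) (?p z) (?p (m z))"
    if "x \<in> endpoints n" "z \<in> endpoints n" "z \<noteq> x" "z \<noteq> m x" for x z
    using nc that unfolding noncrossing_graph[OF m] by blast
  note tc = turn_cap(1)[OF ne, of m] turn_cap(2)[of a b m]
  note fa = matching_funD[OF m ab(1)] and fb = matching_funD[OF m ab(2)]
  \<comment> \<open>The new arc runs parallel to the two old ones, because \<open>a\<close> and \<open>b\<close> are neighbours.\<close>
  have new: "\<not> crossed (?p (m a)) (?p (m b)) (?p z) (?p (m z))"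
    if z: "z \<in> endpoints n" "z \<notin> {a, b, m a, m b}" for z
  proof
    note fz = matching_funD[OF m z(1)]
    assume "crossed (?p (m a)) (?p (m b)) (?p z) (?p (m z))"
    moreover have "m z \<notin> {a, b}" using z(2) fz(3) by auto
    then have "?p z \<noteq> ?p a" "?p z \<noteq> ?p b" "?p (m z) \<noteq> ?p a" "?p (m z) \<noteq> ?p b"
      using inj[OF _ z(1) ab(1)] inj[OF _ z(1) ab(2)] inj[OF _ fz(1) ab(1)] inj[OF _ fz(1) ab(2)] z(2)
      by blast+
    ultimately have "crossed (?p a) (?p (m a)) (?p z) (?p (m z)) \<or>
      crossed (?p b) (?p (m b)) (?p z) (?p (m z))"
      by (intro crossed_surgery[OF ab(3)])
    with nc'[OF ab(1) z(1)] nc'[OF ab(2) z(1)] z(2) show False by blast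
  qed
  have old: "?t z = m z" if "z \<notin> {a, b, m a, m b}" for z
    using that by (auto simp: turn_def)
  have cap: "\<not> crossed (?p x) (?p (?t x)) (?p z) (?p (?t z))"
    if "x \<in> {a, b}" "z \<in> endpoints n" "z \<notin> {a, b}" for x z
  proof -
    have tz: "?t z \<in> endpoints n" "?t z \<notin> {a, b}"
      using matching_funD[OF t that(2)] that(3) tc by (blast, metis insertE singletonD insertCI)
    have "?p z \<notin> {?p b, Suc (?p b)}" "?p (?t z) \<notin> {?p b, Suc (?p b)}"
      using inj[OF _ that(2) ab(1)] inj[OF _ that(2) ab(2)] inj[OF _ tz(1) ab(1)]
        inj[OF _ tz(1) ab(2)] ab(3) that(3) tz(2) by auto
    note nc2 = not_crossed_consecutive[OF this]
    from that(1) consider "x = a" | "x = b" by blast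
    then show ?thesis
      by cases (use nc2 tc ab(3) in simp_all)
  qed
  have third: "\<not> crossed (?p x) (?p (?t x)) (?p z) (?p (?t z))"
    if x: "x \<in> {m a, m b}" "x \<notin> {a, b}" and z: "z \<in> endpoints n" "z \<notin> {a, b, m a, m b}" for x z
  proof -
    have "m a \<noteq> m b" using ne fa(3) fb(3) by metis
    then have "(x = m a \<and> ?t x = m b) \<or> (x = m b \<and> ?t x = m a)"
      using x by (auto simp: turn_def)
    with new[OF z] old[OF z(2)] crossed_swap(1) show ?thesis by metis
  qed
  show ?thesis
    unfolding noncrossing_graph[OF t]
  proof (intro ballI impI)
    fix x z assume x: "x \<in> endpoints n" and z: "z \<in> endpoints n" and xz: "z \<noteq> x" "z \<noteq> ?t x"
    have tx: "?t x \<in> endpoints n" "?t (?t x) = x" and tz: "?t z \<in> endpoints n" "?t (?t z) = z"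
      using matching_funD[OF t x] matching_funD[OF t z] by blast+
    have xz': "?t z \<noteq> x" "?t z \<noteq> ?t x" using xz tx tz by metis+
    \<comment> \<open>Exchanging the two arcs reduces the cases where \<open>z\<close> lies on the
      cap or on the arc of former partners to those where \<open>x\<close> does.\<close>
    have sym: "crossed (?p x) (?p (?t x)) (?p z) (?p (?t z)) \<longleftrightarrow>
      crossed (?p z) (?p (?t z)) (?p x) (?p (?t x))"
      using inj[OF xz(1) z x] inj[OF xz(2) z tx(1)] inj[OF xz'(1) tz(1) x] inj[OF xz'(2) tz(1) tx(1)]
      by (intro crossed_sym) simp_all
    have cases4: "u \<in> {a, b} \<or> u \<in> {m a, m b} \<and> u \<notin> {a, b} \<or> u \<notin> {a, b, m a, m b}" for u
      by blast
    have "z \<notin> {a, b}" if "x \<in> {a, b}" using that xz tc by auto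
    moreover have "x \<notin> {a, b}" if "z \<in> {a, b}" using that xz' xz tc by auto
    moreover have "z \<notin> {m a, m b}" if "x \<in> {m a, m b}" "x \<notin> {a, b}"
    proof -
      have "m a \<noteq> m b" using ne fa(3) fb(3) by metis
      then show ?thesis using that xz by (auto simp: turn_def)
    qed
    ultimately consider "x \<in> {a, b}" "z \<notin> {a, b}" | "z \<in> {a, b}" "x \<notin> {a, b}"
      | "x \<in> {m a, m b}" "x \<notin> {a, b}" "z \<notin> {a, b, m a, m b}"
      | "z \<in> {m a, m b}" "z \<notin> {a, b}" "x \<notin> {a, b, m a, m b}"
      | "x \<notin> {a, b, m a, m b}" "z \<notin> {a, b, m a, m b}"
      using cases4[of x] cases4[of z] by blast
    then show "\<not> crossed (?p x) (?p (?t x)) (?p z) (?p (?t z))"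
    proof cases
      case 1
      then show ?thesis using cap z by blast
    next
      case 2
      then show ?thesis using cap x sym by blast
    next
      case 3
      then show ?thesis using third z by blast
    next
      case 4
      then show ?thesis using third x sym by blast
    next
      case 5
      then show ?thesis using old[of x] old[of z] nc'[OF x z xz(1)] xz(2) by simp
    qed
  qed
qed

text \<open>An innermost arc between two top points is a cap. Without caps all top points are
  therefore joined to bottom points, planarity makes this assignment strictly increasing, and an
  increasing self-map of \<open>{1..n}\<close> is the identity.\<close>

lemma exists_cap:
  assumes m: "matching_fun n m" and nc: "noncrossing n (graph n m)"
    and ne: "graph n m \<noteq> id_diagram n"
  shows "\<exists>i\<in>{1..<n}. m (1, i) = (1, Suc i)"
proof (rule ccontr)
  assume no: "\<not> ?thesis"
  let ?p = "boundary_pos n"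
  have nc': "\<not> (?p x < ?p z \<and> ?p z < ?p (m x) \<and> ?p (m x) < ?p (m z))"
    if "x \<in> endpoints n" "z \<in> endpoints n" for x z
    using nc that unfolding noncrossing_def mem_graph by blast
  have ep: "(1, k) \<in> endpoints n" if "k \<in> {1..n}" for k
    using that by (simp add: mem_endpoints)
  have noarc: "m (1, k) \<noteq> (1, l)" if "k \<in> {1..n}" "l \<in> {1..n}" "k < l" for k l
    using that
  proof (induction "l - k" arbitrary: k l rule: less_induct)
    case less
    show ?case
    proof
      assume kl: "m (1, k) = (1, l)"
      have lk: "m (1, l) = (1, k)" using matching_funD(3)[OF m ep[OF less.prems(1)]] kl by simp
      show False
      proof (cases "l = Suc k")
        case True
        then show False using no kl less.prems by auto
      next
        case False
        then have k: "Suc k \<in> {1..n}" "Suc k < l" using less.prems by auto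
        obtain h r where r: "m (1, Suc k) = (h, r)" by (cases "m (1, Suc k)") auto
        have re: "(h, r) \<in> endpoints n" "m (h, r) = (1, Suc k)" "(h, r) \<noteq> (1, Suc k)"
          using matching_funD[OF m ep[OF k(1)]] r by auto
        have nkl: "(h, r) \<noteq> (1, k)" "(h, r) \<noteq> (1, l)" using re(2) kl lk k by auto
        \<comment> \<open>The arc starting just inside the arc from \<open>k\<close> to
          \<open>l\<close> cannot leave the region which that arc cuts off. It is thus a shorter arc
          between top points, excluded by the induction hypothesis.\<close>
        have "h = 1 \<and> k < r \<and> r < l"
        proof -
          have h: "h = 0 \<or> h = 1" "r \<in> {1..n}" using re(1) by (auto simp: mem_endpoints)
          have "?p (1, l) < ?p (1, Suc k)" "?p (1, Suc k) < ?p (1, k)"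
            using k less.prems by (auto simp: boundary_pos_def)
          then have "\<not> ?p (1, k) < ?p (h, r)" "\<not> ?p (h, r) < ?p (1, l)"
            using nc'[OF ep[OF less.prems(2)] ep[OF k(1)]] nc'[OF re(1) ep[OF less.prems(2)]]
            unfolding re(2) r lk by blast+
          moreover have "\<not> ?p (h, r) < ?p (1, l)  \<Longrightarrow> h = 1"
            using h less.prems by (auto simp: boundary_pos_def)
          moreover have "r \<noteq> k" "r \<noteq> l" if "h = 1" using nkl that by auto
          ultimately show ?thesis using h less.prems by (auto simp: boundary_pos_def)
        qed
        then have "h = 1" "Suc k < r" "r < l" "r \<in> {1..n}" using re by (auto simp: mem_endpoints)
        moreover from this have "r - Suc k < l - k" by linarith
        ultimately show False using less.hyps[of r "Suc k"] k(1) r by blast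
      qed
    qed
  qed
  define f where "f k = snd (m (1, k))" for k
  have mf: "m (1, k) = (0, f k) \<and> f k \<in> {1..n}" if k: "k \<in> {1..n}" for k
  proof -
    obtain h r where r: "m (1, k) = (h, r)" by (cases "m (1, k)") auto
    note fk = matching_funD[OF m ep[OF k]]
    have hr: "h = 0 \<or> h = 1" "r \<in> {1..n}" using fk(1) r by (auto simp: mem_endpoints)
    have "h \<noteq> 1"
    proof
      assume "h = 1"
      with r fk have "m (1, k) = (1, r)" "m (1, r) = (1, k)" "r \<noteq> k" by auto
      with noarc[OF k hr(2)] noarc[OF hr(2) k] show False by (metis linorder_neqE_nat)
    qed
    with hr r show ?thesis by (simp add: f_def)
  qed
  have mono: "f k < f l" if kl: "k \<in> {1..n}" "l \<in> {1..n}" "k < l" for k l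
  proof (rule ccontr)
    assume "\<not> f k < f l"
    moreover have "f k \<noteq> f l"
      using mf[OF kl(1)] mf[OF kl(2)] matching_funD(3)[OF m ep[OF kl(1)]]
        matching_funD(3)[OF m ep[OF kl(2)]] kl(3) by (metis less_irrefl prod.inject)
    ultimately have lt: "f l < f k" by simp
    have e: "(0, f k) \<in> endpoints n" "(0, f l) \<in> endpoints n"
      using mf[OF kl(1)] mf[OF kl(2)] by (simp_all add: mem_endpoints)
    have "m (0, f k) = (1, k)" "m (0, f l) = (1, l)"
      using mf[OF kl(1)] mf[OF kl(2)] matching_funD(3)[OF m ep[OF kl(1)]]
        matching_funD(3)[OF m ep[OF kl(2)]] by simp_all
    with nc'[OF e(2) e(1)] lt kl mf[OF kl(1)] show False by (auto simp: boundary_pos_def)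
  qed
  \<comment> \<open>Strict growth pushes \<open>f\<close> above the identity when counting up from 1
    and below it when counting down from \<open>n\<close>.\<close>
  have ge: "k \<le> f k" if "k \<in> {1..n}" for k
    using that
  proof (induction k)
    case (Suc k)
    show ?case
    proof (cases "k = 0")
      case True
      then show ?thesis using mf[OF Suc.prems] by simp
    next
      case False
      then show ?thesis using Suc mono[of k "Suc k"] by force
    qed
  qed simp
  have le: "f k \<le> k" if "k \<in> {1..n}" for k
    using that
  proof (induction "n - k" arbitrary: k)
    case 0
    then show ?case using mf[OF 0(2)] by simp
  next
    case (Suc d)
    then have "Suc k \<in> {1..n}" by auto
    moreover from this have "f (Suc k) \<le> Suc k" using Suc.hyps by auto
    ultimately show ?case using mono[of k "Suc k"] Suc.prems by auto
  qed
  have m1: "m (1, k) = (0, k)" "m (0, k) = (1, k)" if "k \<in> {1..n}" for k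
    using mf[OF that] ge[OF that] le[OF that] matching_funD(3)[OF m ep[OF that]] by auto
  have "graph n m = id_diagram n"
  proof (intro set_eqI)
    fix e :: "point \<times> point"
    obtain h k y where e: "e = ((h, k), y)" by (metis surj_pair)
    show "e \<in> graph n m \<longleftrightarrow> e \<in> id_diagram n"
      unfolding e mem_graph using m1[of k] by (auto simp: id_diagram_def mem_endpoints)
  qed
  with ne show False ..
qed

section \<open>Reflection\<close>

text \<open>The parameter is 1 for mirroring a single diagram and 2 for a stacked pair. Points above
  height \<open>h\<close> stay in place, so that the map is an involution on all points.\<close>

definition flip_height :: "nat \<Rightarrow> point \<Rightarrow> point" where
  "flip_height h x = (if fst x \<le> h then h - fst x else fst x, snd x)"

definition flip :: "diagram \<Rightarrow> diagram" where
  "flip D = map_prod (flip_height (Suc 0)) (flip_height (Suc 0)) ` D"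

lemma flip_height_invol [simp]: "flip_height h (flip_height h x) = x"
  by (cases x) (auto simp: flip_height_def)

lemma flip_flip [simp]: "flip (flip D) = D"
  unfolding flip_def by (force simp: image_image map_prod_def split_beta)

lemma mem_flip: "(x, y) \<in> flip D \<longleftrightarrow> (flip_height (Suc 0) x, flip_height (Suc 0) y) \<in> D"
proof
  assume "(x, y) \<in> flip D"
  then obtain u v where uv: "(u, v) \<in> D" "x = flip_height (Suc 0) u" "y = flip_height (Suc 0) v"
    unfolding flip_def by (elim imageE) (metis map_prod_simp prod.inject surj_pair)
  then show "(flip_height (Suc 0) x, flip_height (Suc 0) y) \<in> D" by simp
next
  assume "(flip_height (Suc 0) x, flip_height (Suc 0) y) \<in> D"
  then have "map_prod (flip_height (Suc 0)) (flip_height (Suc 0)) (flip_height (Suc 0) x, flip_height (Suc 0) y) \<in> flip D"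
    unfolding flip_def by (rule imageI)
  then show "(x, y) \<in> flip D" by simp
qed

lemma diagram_eqI: "(\<And>x y. (x, y) \<in> A \<longleftrightarrow> (x, y) \<in> B) \<Longrightarrow> A = (B :: diagram)"
  by (intro set_eqI) (metis surj_pair)

lemma flip_height_endpoints [simp]: "flip_height (Suc 0) x \<in> endpoints n \<longleftrightarrow> x \<in> endpoints n"
  by (cases x) (auto simp: flip_height_def mem_endpoints)

lemma flip_id_diagram: "flip (id_diagram n) = id_diagram n"
proof (rule diagram_eqI)
  fix x y show "(x, y) \<in> flip (id_diagram n) \<longleftrightarrow> (x, y) \<in> id_diagram n"
    unfolding mem_flip id_diagram_def by (cases x; cases y) (auto simp: flip_height_def split: if_splits)
qed

lemma flip_turnback_diagram: "flip (turnback_diagram n i) = turnback_diagram n i"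
proof (rule diagram_eqI)
  fix x y show "(x, y) \<in> flip (turnback_diagram n i) \<longleftrightarrow> (x, y) \<in> turnback_diagram n i"
    unfolding mem_flip turnback_diagram_fused fused_def
    by (cases x; cases y) (auto simp: flip_height_def split: if_splits)
qed

lemma flip_graph:
  "flip (graph n m) = graph n (flip_height (Suc 0) \<circ> m \<circ> flip_height (Suc 0))"
proof (rule diagram_eqI)
  fix x y show "(x, y) \<in> flip (graph n m) \<longleftrightarrow> (x, y) \<in> graph n (flip_height (Suc 0) \<circ> m \<circ> flip_height (Suc 0))"
    unfolding mem_flip mem_graph comp_def flip_height_endpoints by (metis flip_height_invol)
qed

lemma matching_fun_flip:
  assumes "matching_fun n m"
  shows "matching_fun n (flip_height (Suc 0) \<circ> m \<circ> flip_height (Suc 0))"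
  unfolding matching_fun_def
proof
  fix x assume x: "x \<in> endpoints n"
  then have x': "flip_height (Suc 0) x \<in> endpoints n" by simp
  note f = matching_funD[OF assms x']
  have "flip_height (Suc 0) (m (flip_height (Suc 0) x)) \<noteq> x" using f(2) by (metis flip_height_invol)
  with f show "(flip_height (Suc 0) \<circ> m \<circ> flip_height (Suc 0)) x \<in> endpoints n \<and>
    (flip_height (Suc 0) \<circ> m \<circ> flip_height (Suc 0)) x \<noteq> x \<and>
    (flip_height (Suc 0) \<circ> m \<circ> flip_height (Suc 0)) ((flip_height (Suc 0) \<circ> m \<circ> flip_height (Suc 0)) x) = x"
    by simp
qed

lemma boundary_pos_flip:
  "x \<in> endpoints n \<Longrightarrow> boundary_pos n (flip_height (Suc 0) x) = 2 * n + 1 - boundary_pos n x"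
  by (cases x) (auto simp: flip_height_def mem_endpoints boundary_pos_def)

lemma boundary_pos_le: "x \<in> endpoints n \<Longrightarrow> boundary_pos n x \<le> 2 * n"
  by (cases x) (auto simp: mem_endpoints boundary_pos_def)

lemma planar_diagramsE:
  assumes "D \<in> planar_diagrams n"
  obtains m where "matching_fun n m" "noncrossing n (graph n m)" "D = graph n m"
proof -
  have D: "perfect_matching n D" "noncrossing n D" using assms by (simp_all add: planar_diagrams_def)
  from perfect_matchingE[OF D(1)] show thesis using that[of "partner D"] D(2) by metis
qed

lemma graph_planar_diagrams:
  "matching_fun n m \<Longrightarrow> noncrossing n (graph n m) \<Longrightarrow> graph n m \<in> planar_diagrams n"
  by (simp add: planar_diagrams_def perfect_matching_graph)

lemma planar_diagrams_subset: "D \<in> planar_diagrams n \<Longrightarrow> D \<subseteq> endpoints n \<times> endpoints n"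
  by (simp add: planar_diagrams_def perfect_matching_def)

text \<open>Reflection reverses the order of boundary positions. A forbidden pattern a, c, b, d
  becomes d, b, c, a, which is again forbidden once both arcs are read backwards.\<close>

lemma flip_planar_diagrams:
  assumes "D \<in> planar_diagrams n"
  shows "flip D \<in> planar_diagrams n"
proof -
  let ?p = "boundary_pos n"
  obtain m where m: "matching_fun n m" "noncrossing n (graph n m)" "D = graph n m"
    using assms by (rule planar_diagramsE)
  have symD: "(v, u) \<in> D" if "(u, v) \<in> D" for u v
    using that sym_graph[OF m(1)] unfolding m(3) by (rule symD[rotated])
  have "noncrossing n (flip D)"
    unfolding noncrossing_def
  proof (intro notI, elim exE conjE)
    fix a b c d
    assume e: "(a, b) \<in> flip D" "(c, d) \<in> flip D"
      and lt: "?p a < ?p c" "?p c < ?p b" "?p b < ?p d"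
    define a' b' c' d' where defs: "a' = flip_height (Suc 0) a" "b' = flip_height (Suc 0) b"
      "c' = flip_height (Suc 0) c" "d' = flip_height (Suc 0) d"
    have e': "(a', b') \<in> D" "(c', d') \<in> D" using e unfolding mem_flip defs by auto
    then have "a' \<in> endpoints n" "b' \<in> endpoints n" "c' \<in> endpoints n" "d' \<in> endpoints n"
      using planar_diagrams_subset[OF assms] by auto
    then have "a \<in> endpoints n" "b \<in> endpoints n" "c \<in> endpoints n" "d \<in> endpoints n"
      unfolding defs by simp_all
    then have "?p d' < ?p b'" "?p b' < ?p c'" "?p c' < ?p a'"
      using lt boundary_pos_le[of d n] boundary_pos_le[of b n] boundary_pos_le[of c n]
      unfolding defs by (auto simp: boundary_pos_flip)
    moreover have "(d', c') \<in> D" "(b', a') \<in> D" using symD e' by auto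
    ultimately show False
      using m(2) unfolding m(3)[symmetric] noncrossing_def by blast
  qed
  then show ?thesis
    using matching_fun_flip[OF m(1)] unfolding m(3) flip_graph by (rule graph_planar_diagrams[rotated])
qed

lemma bij_betw_flip: "bij_betw flip (planar_diagrams n) (planar_diagrams n)"
  by (rule bij_betwI[where g = flip]) (auto simp: flip_planar_diagrams)

text \<open>Reflection in the middle line exchanges the layers, so the mirrored \<open>B\<close>
  lies below the mirrored \<open>A\<close>. Restricting the diagrams to \<open>endpoints n\<close>
  keeps their heights in the range where the truncated subtraction in \<open>flip_height\<close> is
  a reflection.\<close>

lemma flip_same_component:
  assumes A: "A \<subseteq> endpoints n \<times> endpoints n" and B: "B \<subseteq> endpoints n \<times> endpoints n"
    and "(x, y) \<in> same_component A B"
  shows "(flip_height 2 x, flip_height 2 y) \<in> same_component (flip B) (flip A)"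
  using assms(3) unfolding same_component_def
proof (induction rule: rtrancl_induct)
  case (step y z)
  have "(flip_height 2 y, flip_height 2 z) \<in> flip B \<union> raise (flip A)"
  proof (cases "(y, z) \<in> A")
    case True
    then have "y \<in> endpoints n" "z \<in> endpoints n" using A by auto
    then obtain h i k j where yz: "y = (h, i)" "z = (k, j)" "h \<le> 1" "k \<le> 1"
      by (cases y; cases z) (auto simp: mem_endpoints)
    have "((1 - h, i), (1 - k, j)) \<in> flip A"
      unfolding mem_flip using True yz by (simp add: flip_height_def)
    then have "((Suc (1 - h), i), (Suc (1 - k), j)) \<in> raise (flip A)"
      unfolding raise_def by blast
    moreover have "flip_height 2 y = (Suc (1 - h), i)" "flip_height 2 z = (Suc (1 - k), j)"
      using yz by (auto simp: flip_height_def)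
    ultimately show ?thesis by simp
  next
    case False
    then obtain h i k j where yz: "y = (Suc h, i)" "z = (Suc k, j)" "((h, i), (k, j)) \<in> B"
      using step.hyps(2) unfolding raise_def by blast
    then have "h \<le> 1" "k \<le> 1" using B by (auto simp: mem_endpoints)
    with yz have "(flip_height 2 y, flip_height 2 z) \<in> flip B"
      unfolding mem_flip by (simp add: flip_height_def)
    then show ?thesis by blast
  qed
  with step.IH show ?case by (rule rtrancl_into_rtrancl)
qed simp

lemma flip_subset:
  assumes "A \<subseteq> endpoints n \<times> endpoints n"
  shows "flip A \<subseteq> endpoints n \<times> endpoints n"
proof
  fix e assume "e \<in> flip A"
  then obtain x y where e: "e = (x, y)" "(flip_height (Suc 0) x, flip_height (Suc 0) y) \<in> A"
    unfolding mem_flip[symmetric] by (metis surj_pair)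
  then show "e \<in> endpoints n \<times> endpoints n"
    using assms by auto
qed

lemma flip_same_component_iff:
  assumes "A \<subseteq> endpoints n \<times> endpoints n" "B \<subseteq> endpoints n \<times> endpoints n"
  shows "(x, y) \<in> same_component (flip B) (flip A) \<longleftrightarrow>
    (flip_height 2 x, flip_height 2 y) \<in> same_component A B"
  using flip_same_component[OF assms, of "flip_height 2 x" "flip_height 2 y"]
    flip_same_component[OF flip_subset[OF assms(2)] flip_subset[OF assms(1)], of x y]
  by auto

lemma flip_stack:
  assumes "A \<subseteq> endpoints n \<times> endpoints n" "B \<subseteq> endpoints n \<times> endpoints n"
  shows "stack n (flip B) (flip A) = flip (stack n A B)"
proof (rule diagram_eqI)
  have mem: "(x, y) \<in> stack n C D \<longleftrightarrow> x \<in> endpoints n \<and> y \<in> endpoints n \<and> x \<noteq> y \<and>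
    ((2 * fst x, snd x), (2 * fst y, snd y)) \<in> same_component C D" for x y C D
    unfolding stack_def by (cases x; cases y) simp
  have dbl: "flip_height 2 (2 * fst x, snd x) = (2 * fst (flip_height (Suc 0) x), snd (flip_height (Suc 0) x))"
    if "x \<in> endpoints n" for x
    using that by (auto simp: flip_height_def mem_endpoints)
  have inj: "flip_height (Suc 0) x = flip_height (Suc 0) y \<longleftrightarrow> x = y" for x y
    by (metis flip_height_invol)
  fix x y
  show "(x, y) \<in> stack n (flip B) (flip A) \<longleftrightarrow> (x, y) \<in> flip (stack n A B)"
    unfolding mem_flip mem flip_same_component_iff[OF assms] inj
    using dbl[of x] dbl[of y] by auto
qed

text \<open>A component inside the middle line is fixed pointwise by the reflection, so the very
  same set of points is a component of the mirrored picture.\<close>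

lemma circles_flip_le:
  assumes "A \<subseteq> endpoints n \<times> endpoints n" "B \<subseteq> endpoints n \<times> endpoints n"
  shows "{C \<in> levels n // same_component A B. C \<subseteq> level n 1} \<subseteq>
    {C \<in> levels n // same_component (flip B) (flip A). C \<subseteq> level n 1}"
proof
  let ?S = "same_component A B" and ?S' = "same_component (flip B) (flip A)"
  fix C assume "C \<in> {C \<in> levels n // ?S. C \<subseteq> level n 1}"
  then have C: "C \<in> levels n // ?S" "C \<subseteq> level n 1" by blast+
  from C(1) obtain x where x: "x \<in> levels n" "C = ?S `` {x}" by (elim quotientE)
  have "x \<in> C" unfolding x(2) same_component_def by blast
  have fixed: "flip_height 2 y = y \<longleftrightarrow> fst y = 1 \<or> fst y > 2" "fst (flip_height 2 y) = 1 \<longleftrightarrow> fst y = 1" for y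
    by (cases y; auto simp: flip_height_def)+
  have one: "fst y = 1" if "y \<in> level n 1" for y using that by (auto simp: level_def)
  have fx: "flip_height 2 x = x" using one fixed(1) C(2) \<open>x \<in> C\<close> by blast
  have "(x, y) \<in> ?S' \<longleftrightarrow> y \<in> C" for y
  proof -
    have "(x, y) \<in> ?S' \<longleftrightarrow> flip_height 2 y \<in> C"
      unfolding flip_same_component_iff[OF assms] fx x(2) by blast
    moreover have "fst y = 1 \<Longrightarrow> flip_height 2 y = y" using fixed(1) by blast
    ultimately show ?thesis
      using one C(2) fixed(2)[of y] by (metis subsetD)
  qed
  then have "C = ?S' `` {x}" by blast
  with x(1) C(2) show "C \<in> {C \<in> levels n // ?S'. C \<subseteq> level n 1}"
    by (simp add: quotientI)
qed

lemma flip_circles: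
  assumes "A \<subseteq> endpoints n \<times> endpoints n" "B \<subseteq> endpoints n \<times> endpoints n"
  shows "circles n (flip B) (flip A) = circles n A B"
proof -
  have "{C \<in> levels n // same_component A B. C \<subseteq> level n 1} =
    {C \<in> levels n // same_component (flip B) (flip A). C \<subseteq> level n 1}"
    using circles_flip_le[OF assms] circles_flip_le[OF flip_subset[OF assms(2)] flip_subset[OF assms(1)]]
    by (intro equalityI) (simp_all only: flip_flip)
  then show ?thesis unfolding circles_def levels_def[symmetric] by (simp only:)
qed

text \<open>The involution exchanging the two ends of each vertical strand is the reflection of
  endpoints itself.\<close>

lemma id_diagram_graph:
  "id_diagram n = graph n (flip_height (Suc 0))" "matching_fun n (flip_height (Suc 0))"
proof -
  show "id_diagram n = graph n (flip_height (Suc 0))"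
  proof (rule diagram_eqI)
    fix x y show "(x, y) \<in> id_diagram n \<longleftrightarrow> (x, y) \<in> graph n (flip_height (Suc 0))"
      unfolding mem_graph id_diagram_def
      by (cases x; cases y) (auto simp: flip_height_def mem_endpoints split: if_splits)
  qed
  show "matching_fun n (flip_height (Suc 0))"
    unfolding matching_fun_def
  proof
    fix x assume "x \<in> endpoints n"
    moreover from this have "flip_height (Suc 0) x \<noteq> x"
      by (cases x) (auto simp: flip_height_def mem_endpoints)
    ultimately show "flip_height (Suc 0) x \<in> endpoints n \<and> flip_height (Suc 0) x \<noteq> x \<and>
      flip_height (Suc 0) (flip_height (Suc 0) x) = x" by simp
  qed
qed

lemma id_diagram_planar: "id_diagram n \<in> planar_diagrams n"
proof -
  have "noncrossing n (graph n (flip_height (Suc 0)))"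
    unfolding noncrossing_def mem_graph
    by (auto simp: boundary_pos_flip mem_endpoints boundary_pos_def flip_height_def split: if_splits)
  then show ?thesis
    unfolding id_diagram_graph(1) using id_diagram_graph(2) by (rule graph_planar_diagrams[rotated])
qed

lemma stack_id_planar:
  assumes "A \<in> planar_diagrams n"
  shows "stack n A (id_diagram n) = A" "circles n A (id_diagram n) = 0"
  using planar_diagramsE[OF assms] stack_id_diagram circles_id_diagram by metis+

section \<open>Composites of planar diagrams with turnbacks\<close>

context
  fixes n i :: nat
  assumes i: "i \<in> {1..<n}"
begin

lemma cap_endpoints:
  "h \<le> 1 \<Longrightarrow> (h, i) \<in> endpoints n" "h \<le> 1 \<Longrightarrow> (h, Suc i) \<in> endpoints n"
  using i by (auto simp: mem_endpoints)

lemma stack_turnback_planar: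
  assumes "A \<in> planar_diagrams n"
  shows "stack n A (turnback_diagram n i) \<in> planar_diagrams n"
    and "((1, i), (1, Suc i)) \<in> stack n A (turnback_diagram n i)"
    and "circles n A (turnback_diagram n i) = (if ((1, i), (1, Suc i)) \<in> A then 1 else 0)"
    and "((1, i), (1, Suc i)) \<in> A \<Longrightarrow> stack n A (turnback_diagram n i) = A"
proof -
  let ?a = "(1, i) :: point" and ?b = "(1, Suc i) :: point"
  obtain m where m: "matching_fun n m" "noncrossing n (graph n m)" "A = graph n m"
    using assms by (rule planar_diagramsE)
  have ab: "?a \<in> endpoints n" "?b \<in> endpoints n" using cap_endpoints by auto
  have pos: "boundary_pos n ?a = Suc (boundary_pos n ?b)" using i by (auto simp: boundary_pos_def)
  have st: "stack n A (turnback_diagram n i) = graph n (turn ?a ?b m)"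
    unfolding m(3) by (rule stack_turnback_diagram[OF m(1) i])
  have A: "(?a, ?b) \<in> A \<longleftrightarrow> m ?a = ?b" unfolding m(3) mem_graph using ab by auto
  show "stack n A (turnback_diagram n i) \<in> planar_diagrams n"
    unfolding st by (intro graph_planar_diagrams matching_fun_turn noncrossing_turn m ab pos) simp
  show "(?a, ?b) \<in> stack n A (turnback_diagram n i)"
    unfolding st mem_graph using ab turn_cap(1)[of ?a ?b m] by simp
  show "circles n A (turnback_diagram n i) = (if (?a, ?b) \<in> A then 1 else 0)"
    unfolding A using circles_turnback_diagram[OF m(1) i] m(3) by simp
  show "stack n A (turnback_diagram n i) = A" if "(?a, ?b) \<in> A"
    unfolding st using that A turn_id[of m ?a ?b] matching_funD(3)[OF m(1) ab(1)] m(3) by simp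
qed

text \<open>Planarity is inherited from the identity diagram, from which the turnback diagram arises
  by one surgery.\<close>

lemma turnback_planar: "turnback_diagram n i \<in> planar_diagrams n"
proof -
  let ?m = "turn (1, i) (1, Suc i) (flip_height (Suc 0))"
  have "turnback_diagram n i = graph n ?m"
  proof (rule diagram_eqI)
    fix x y
    obtain h k :: nat where x: "x = (h, k)" by (metis surj_pair)
    have m: "?m (1, i) = (1, Suc i)" "?m (1, Suc i) = (1, i)" "?m (0, i) = (0, Suc i)" "?m (0, Suc i) = (0, i)"
      "k \<notin> {i, Suc i} \<Longrightarrow> h \<le> 1 \<Longrightarrow> ?m (h, k) = (1 - h, k)"
      by (auto simp: turn_def flip_height_def)
    show "(x, y) \<in> turnback_diagram n i \<longleftrightarrow> (x, y) \<in> graph n ?m"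
      unfolding mem_graph x turnback_diagram_def using i m
      by (cases "k = i"; cases "k = Suc i"; cases "h = 0"; cases "h = 1") (auto simp: mem_endpoints)
  qed
  also have "\<dots> = stack n (id_diagram n) (turnback_diagram n i)"
    unfolding id_diagram_graph(1) stack_turnback_diagram[OF id_diagram_graph(2) i] ..
  finally show ?thesis using stack_turnback_planar(1)[OF id_diagram_planar] by simp
qed

text \<open>Conjugating by the reflection moves the surgery from the top line to the bottom line and
  reverses the order of the factors.\<close>

lemma turnback_stack:
  assumes "matching_fun n m"
  shows "stack n (turnback_diagram n i) (graph n m) = graph n (turn (0, i) (0, Suc i) m)"
    and "circles n (turnback_diagram n i) (graph n m) = (if m (0, i) = (0, Suc i) then 1 else 0)"
proof -
  let ?f = "flip_height (Suc 0)" and ?t = "turnback_diagram n i"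
  have sub: "flip (graph n m) \<subseteq> endpoints n \<times> endpoints n" "?t \<subseteq> endpoints n \<times> endpoints n"
    using perfect_matching_graph[OF assms] planar_diagrams_subset[OF turnback_planar]
    by (auto intro!: flip_subset simp: perfect_matching_def)
  have fe: "?f (Suc 0, k) = (0, k)" "?f (0, k) = (Suc 0, k)" for k by (simp_all add: flip_height_def)
  have inj: "?f x = y \<longleftrightarrow> x = ?f y" for x y by (metis flip_height_invol)
  have "stack n ?t (graph n m) = flip (stack n (flip (graph n m)) ?t)"
    using flip_stack[OF sub] by (simp add: flip_turnback_diagram)
  also have "\<dots> = graph n (?f \<circ> turn (1, i) (1, Suc i) (?f \<circ> m \<circ> ?f) \<circ> ?f)"
    unfolding flip_graph stack_turnback_diagram[OF matching_fun_flip[OF assms] i] ..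
  also have "?f \<circ> turn (1, i) (1, Suc i) (?f \<circ> m \<circ> ?f) \<circ> ?f = turn (0, i) (0, Suc i) m"
    by (rule ext) (simp add: turn_def inj fe split: if_split)
  finally show "stack n ?t (graph n m) = graph n (turn (0, i) (0, Suc i) m)" .
  have "circles n ?t (graph n m) = circles n (flip (graph n m)) ?t"
    using flip_circles[OF sub] by (simp add: flip_turnback_diagram)
  also have "\<dots> = (if m (0, i) = (0, Suc i) then 1 else 0)"
    unfolding flip_graph circles_turnback_diagram[OF matching_fun_flip[OF assms] i]
    by (simp add: fe inj)
  finally show "circles n ?t (graph n m) = (if m (0, i) = (0, Suc i) then 1 else 0)" .
qed

end

lemma turnback_stack_planar:
  assumes "A \<in> planar_diagrams n" "i \<in> {1..<n}"
  shows "stack n (turnback_diagram n i) A \<in> planar_diagrams n"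
    and "((0, i), (0, Suc i)) \<in> stack n (turnback_diagram n i) A"
proof -
  let ?t = "turnback_diagram n i"
  have sub: "flip A \<subseteq> endpoints n \<times> endpoints n" "?t \<subseteq> endpoints n \<times> endpoints n"
    using planar_diagrams_subset flip_planar_diagrams[OF assms(1)] turnback_planar[OF assms(2)] by auto
  have "stack n ?t A = flip (stack n (flip A) ?t)"
    using flip_stack[OF sub] by (simp add: flip_turnback_diagram)
  then show "stack n ?t A \<in> planar_diagrams n" "((0, i), (0, Suc i)) \<in> stack n ?t A"
    using stack_turnback_planar(1,2)[OF assms(2) flip_planar_diagrams[OF assms(1)]]
    by (simp_all add: flip_planar_diagrams mem_flip flip_height_def)
qed

text \<open>Associativity of e_i A e_k, separated into the resulting diagram and the exponent of the
  loop value; it is what makes \<open>left_e\<close> and \<open>right_e\<close> commute.\<close>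

lemma turnbacks_commute:
  assumes "A \<in> planar_diagrams n" "i \<in> {1..<n}" "k \<in> {1..<n}"
  shows "stack n (turnback_diagram n i) (stack n A (turnback_diagram n k)) =
      stack n (stack n (turnback_diagram n i) A) (turnback_diagram n k)"
    and "circles n A (turnback_diagram n k) +
      circles n (turnback_diagram n i) (stack n A (turnback_diagram n k)) =
      circles n (turnback_diagram n i) A +
      circles n (stack n (turnback_diagram n i) A) (turnback_diagram n k)"
proof -
  obtain m where m: "matching_fun n m" "A = graph n m"
    using assms(1) by (rule planar_diagramsE)
  let ?a = "(0, i) :: point" and ?b = "(0, Suc i) :: point"
  let ?c = "(1, k) :: point" and ?d = "(1, Suc k) :: point"
  have e: "?a \<in> endpoints n" "?b \<in> endpoints n" "?c \<in> endpoints n" "?d \<in> endpoints n"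
    using cap_endpoints[OF assms(2)] cap_endpoints[OF assms(3)] by simp_all
  note f = matching_funD[OF m(1) e(1)] matching_funD[OF m(1) e(2)]
    matching_funD[OF m(1) e(3)] matching_funD[OF m(1) e(4)]
  have mc: "matching_fun n (turn ?c ?d m)" and ma: "matching_fun n (turn ?a ?b m)"
    by (intro matching_fun_turn m e; simp)+
  have d: "distinct [?a, ?b, ?c, ?d]" by simp
  show "stack n (turnback_diagram n i) (stack n A (turnback_diagram n k)) =
      stack n (stack n (turnback_diagram n i) A) (turnback_diagram n k)"
    unfolding m(2) stack_turnback_diagram[OF m(1) assms(3)] turnback_stack(1)[OF assms(2) m(1)]
      turnback_stack(1)[OF assms(2) mc] stack_turnback_diagram[OF ma assms(3)]
    using d f matching_funD(3)[OF m(1)] by (intro graph_cong turn_commute) simp_all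
  show "circles n A (turnback_diagram n k) +
      circles n (turnback_diagram n i) (stack n A (turnback_diagram n k)) =
      circles n (turnback_diagram n i) A +
      circles n (stack n (turnback_diagram n i) A) (turnback_diagram n k)"
    unfolding m(2) stack_turnback_diagram[OF m(1) assms(3)] turnback_stack[OF assms(2) m(1)]
      circles_turnback_diagram[OF m(1) assms(3)] turnback_stack(2)[OF assms(2) mc]
      circles_turnback_diagram[OF ma assms(3)]
    using turn_commute_caps[of ?a ?b ?c ?d m] d f by linarith
qed

lemma id_diagram_no_cap:
  "((1, i), (1, Suc i)) \<notin> id_diagram n" "((0, i), (0, Suc i)) \<notin> id_diagram n"
  by (auto simp: id_diagram_def)

lemma exists_cap_planar:
  assumes "D \<in> planar_diagrams n" "D \<noteq> id_diagram n"
  shows "\<exists>i\<in>{1..<n}. ((1, i), (1, Suc i)) \<in> D"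
proof -
  obtain m where m: "matching_fun n m" "noncrossing n (graph n m)" "D = graph n m"
    using assms(1) by (rule planar_diagramsE)
  obtain i where i: "i \<in> {1..<n}" "m (1, i) = (1, Suc i)"
    using exists_cap[OF m(1,2)] assms(2) m(3) by blast
  then have "((1, i), (1, Suc i)) \<in> D"
    unfolding m(3) mem_graph using cap_endpoints(1)[OF i(1), of 1] by simp
  with i(1) show ?thesis by blast
qed

section \<open>Valuation at zero\<close>

definition poly_to_fls :: "complex poly \<Rightarrow> complex fls" where
  "poly_to_fls p = fps_to_fls (fps_of_poly p)"

lemma poly_to_fls_simps [simp]:
  "poly_to_fls (a + b) = poly_to_fls a + poly_to_fls b"
  "poly_to_fls (a * b) = poly_to_fls a * poly_to_fls b"
  "poly_to_fls (- a) = - poly_to_fls a"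
  "poly_to_fls 0 = 0" "poly_to_fls 1 = 1" "poly_to_fls [:0, 1:] = fls_X"
  "poly_to_fls a = 0 \<longleftrightarrow> a = 0"
  using fps_of_poly_eq_iff[of a 0]
  by (simp_all add: poly_to_fls_def fps_of_poly_add fps_of_poly_mult fps_of_poly_uminus
      fls_times_fps_to_fls)

text \<open>\<open>expansion\<close> is defined by the normalized quotient. By cross-multiplication
  every representing fraction gives the same Laurent series, and so \<open>expansion\<close>
  respects the field operations.\<close>

lemma expansion_Fract:
  assumes "b \<noteq> 0"
  shows "expansion (Fract a b) = poly_to_fls a / poly_to_fls b"
proof -
  obtain c d where cd: "quot_of_fract (Fract a b) = (c, d)" by (metis surj_pair)
  have d: "d \<noteq> 0" using snd_quot_of_fract_nonzero[of "Fract a b"] cd by simp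
  have "Fract c d = Fract a b"
    using Fract_quot_of_fract[of "Fract a b"] cd by simp
  then have "c * b = a * d" using assms d by (simp add: eq_fract)
  then have "poly_to_fls c * poly_to_fls b = poly_to_fls a * poly_to_fls d"
    by (metis poly_to_fls_simps(2))
  then have "poly_to_fls c / poly_to_fls d = poly_to_fls a / poly_to_fls b"
    using assms d by (simp add: frac_eq_eq)
  then show ?thesis by (simp add: expansion_def cd poly_to_fls_def)
qed

lemma expansion_add [simp]: "expansion (x + y) = expansion x + expansion y"
  by (cases x; cases y) (simp add: expansion_Fract add_frac_eq mult.commute)

lemma expansion_mult [simp]: "expansion (x * y) = expansion x * expansion y"
  by (cases x; cases y) (simp add: expansion_Fract)

lemma expansion_uminus [simp]: "expansion (- x) = - expansion x"
  by (cases x) (simp add: expansion_Fract)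

lemma expansion_diff [simp]: "expansion (x - y) = expansion x - expansion y"
  using expansion_add[of x "- y"] by simp

lemma expansion_0 [simp]: "expansion 0 = 0" and expansion_1 [simp]: "expansion 1 = 1"
  and expansion_q [simp]: "expansion q = fls_X"
  by (simp_all add: Zero_fract_def One_fract_def q_def to_fract_def expansion_Fract)

lemma expansion_eq_0_iff [simp]: "expansion x = 0 \<longleftrightarrow> x = 0"
  by (cases x) (auto simp: expansion_Fract Zero_fract_def eq_fract)

lemma q_nonzero: "q \<noteq> 0"
  by (metis expansion_0 expansion_q fls_X_nonzero)

text \<open>A lower bound for the q-adic valuation, phrased by vanishing coefficients so that 0
  satisfies every bound without an infinite value.\<close>

definition val_ge :: "int \<Rightarrow> ratfun \<Rightarrow> bool" where
  "val_ge N x \<longleftrightarrow> (\<forall>m < N. fls_nth (expansion x) m = 0)"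

lemma val_ge_0 [simp]: "val_ge N 0"
  by (simp add: val_ge_def)

lemma val_ge_mono: "val_ge N x \<Longrightarrow> M \<le> N \<Longrightarrow> val_ge M x"
  by (simp add: val_ge_def)

lemma val_ge_add: "val_ge N x \<Longrightarrow> val_ge N y \<Longrightarrow> val_ge N (x + y)"
  by (simp add: val_ge_def)

lemma val_ge_uminus: "val_ge N x \<Longrightarrow> val_ge N (- x)"
  by (simp add: val_ge_def)

lemma val_ge_q_mult: "val_ge N x \<Longrightarrow> val_ge (N + 1) (q * x)"
  by (simp add: val_ge_def fls_X_times_conv_shift)

lemma val_ge_sum: "(\<And>a. a \<in> S \<Longrightarrow> val_ge N (f a)) \<Longrightarrow> val_ge N (sum f S)"
  by (induction S rule: infinite_finite_induct) (simp_all add: val_ge_add)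

lemma val_ge_exists: "\<exists>N. val_ge N x"
  unfolding val_ge_def by (metis fls_eq0_below_subdegree)

lemma val_ge_all:
  assumes "\<And>k :: nat. val_ge (N + int k) x"
  shows "x = 0"
proof -
  have "fls_nth (expansion x) m = 0" for m
    \<comment> \<open>This choice makes the bound exceed \<open>m\<close>; for \<open>m < N\<close>
      the truncation to 0 leaves the bound \<open>N\<close>, which already suffices.\<close>
    using assms[of "nat (m + 1 - N)"] by (auto simp: val_ge_def)
  then have "expansion x = 0" by (intro fls_eqI) simp
  then show ?thesis by simp
qed

text \<open>Gaussian elimination with unknowns indexed by \<open>A\<close> and equations by
  \<open>B\<close>. An equation without a pivot holds trivially; a pivot \<open>p\<close> eliminates
  one unknown together with one equation.\<close>

lemma homogeneous_system_nontrivial: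
  fixes M :: "'a \<Rightarrow> 'b \<Rightarrow> 'k :: field"
  assumes "finite B" "finite A" "card B < card A"
  shows "\<exists>c. (\<exists>a\<in>A. c a \<noteq> 0) \<and> (\<forall>b\<in>B. (\<Sum>a\<in>A. c a * M a b) = 0)"
  using assms
proof (induction B arbitrary: A M rule: finite_induct)
  case empty
  then have "A \<noteq> {}" by auto
  then show ?case by (intro exI[of _ "\<lambda>_. 1"]) auto
next
  case (insert b B)
  show ?case
  proof (cases "\<forall>a\<in>A. M a b = 0")
    case True
    have "card B < card A" using insert by simp
    from insert.IH[OF insert.prems(1) this, of M] obtain c where
      "\<exists>a\<in>A. c a \<noteq> 0" "\<forall>b\<in>B. (\<Sum>a\<in>A. c a * M a b) = 0" by blast
    with True show ?thesis by (intro exI[of _ c]) auto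
  next
    case False
    then obtain p where p: "p \<in> A" "M p b \<noteq> 0" by blast
    define M' where "M' a d = M a d - M a b * (M p d / M p b)" for a d
    have "card B < card (A - {p})" using insert p by simp
    with insert.IH[of "A - {p}" M'] insert.prems obtain c where
      c: "\<exists>a\<in>A - {p}. c a \<noteq> 0" "\<And>d. d \<in> B \<Longrightarrow> (\<Sum>a\<in>A - {p}. c a * M' a d) = 0" by auto
    define s where "s = (\<Sum>a\<in>A - {p}. c a * M a b)"
    \<comment> \<open>The value at the pivot is the one that solves equation \<open>b\<close>, given
      the values of the other unknowns.\<close>
    define c' where "c' = c(p := - s / M p b)"
    have split: "(\<Sum>a\<in>A. c' a * M a d) = - s / M p b * M p d + (\<Sum>a\<in>A - {p}. c a * M a d)" for d
      using sum.remove[OF insert.prems(1) p(1), of "\<lambda>a. c' a * M a d"] by (simp add: c'_def)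
    have "(\<Sum>a\<in>A. c' a * M a d) = 0" if "d \<in> insert b B" for d
    proof (cases "d = b")
      case True
      then show ?thesis unfolding split using p(2) by (simp add: s_def)
    next
      case False
      have "(\<Sum>a\<in>A - {p}. c a * M' a d) =
        (\<Sum>a\<in>A - {p}. c a * M a d) - s * (M p d / M p b)"
        unfolding M'_def s_def sum_distrib_right sum_subtractf[symmetric]
        by (simp only: right_diff_distrib mult.assoc)
      then show ?thesis unfolding split using c(2)[of d] that False by simp
    qed
    moreover have "\<exists>a\<in>A. c' a \<noteq> 0" using c(1) by (auto simp: c'_def)
    ultimately show ?thesis by blast
  qed
qed

section \<open>Multiplication by generators\<close>

text \<open>The common shape of multiplication by a fixed diagram from the left and from the right:
  \<open>A\<close> goes to the diagram \<open>s A\<close> with \<open>c A\<close> circles removed.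
  Linearity and composition are thereby treated once for both sides.\<close>

definition diagram_op :: "nat \<Rightarrow> (diagram \<Rightarrow> nat) \<Rightarrow> (diagram \<Rightarrow> diagram) \<Rightarrow> tl \<Rightarrow> tl" where
  "diagram_op n c s x = (\<lambda>D. \<Sum>A\<in>planar_diagrams n. x A * ((q + inverse q) ^ c A * tl_basis (s A) D))"

definition right_e :: "nat \<Rightarrow> nat \<Rightarrow> tl \<Rightarrow> tl" where
  "right_e n i x = tl_mult n x (tl_e n i)"

definition left_e :: "nat \<Rightarrow> nat \<Rightarrow> tl \<Rightarrow> tl" where
  "left_e n i x = tl_mult n (tl_e n i) x"

text \<open>Right multiplication by 1 - q e_i. A positive crossing contributes q times this operator
  and a negative one - q^(-2) times it.\<close>

definition cross_op :: "nat \<Rightarrow> tl \<Rightarrow> nat \<Rightarrow> tl" where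
  "cross_op n x i = (\<lambda>D. x D - q * right_e n i x D)"

lemma right_e_eq_op:
  assumes "i \<in> {1..<n}"
  shows "right_e n i x = diagram_op n (\<lambda>A. circles n A (turnback_diagram n i))
    (\<lambda>A. stack n A (turnback_diagram n i)) x"
proof (rule ext)
  fix D
  have "(\<Sum>B\<in>planar_diagrams n. x A * tl_e n i B *
      ((q + inverse q) ^ circles n A B * tl_basis (stack n A B) D)) =
    x A * ((q + inverse q) ^ circles n A (turnback_diagram n i) *
      tl_basis (stack n A (turnback_diagram n i)) D)" for A
  proof -
    have "(\<Sum>B\<in>planar_diagrams n. x A * tl_e n i B *
        ((q + inverse q) ^ circles n A B * tl_basis (stack n A B) D)) =
      (\<Sum>B\<in>planar_diagrams n. if B = turnback_diagram n i
        then x A * ((q + inverse q) ^ circles n A B * tl_basis (stack n A B) D) else 0)"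
      by (intro sum.cong refl) (simp add: tl_e_def tl_basis_def)
    then show ?thesis
      using turnback_planar[OF assms] by (simp add: finite_planar_diagrams)
  qed
  then show "right_e n i x D = diagram_op n (\<lambda>A. circles n A (turnback_diagram n i))
    (\<lambda>A. stack n A (turnback_diagram n i)) x D"
    by (simp add: right_e_def tl_mult_def diagram_op_def)
qed

lemma left_e_eq_op:
  assumes "i \<in> {1..<n}"
  shows "left_e n i x = diagram_op n (\<lambda>A. circles n (turnback_diagram n i) A)
    (\<lambda>A. stack n (turnback_diagram n i) A) x"
proof (rule ext)
  fix D
  have "left_e n i x D = (\<Sum>A\<in>planar_diagrams n. if A = turnback_diagram n i
    then \<Sum>B\<in>planar_diagrams n. x B * ((q + inverse q) ^ circles n A B * tl_basis (stack n A B) D)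
    else 0)"
    unfolding left_e_def tl_mult_def by (intro sum.cong refl) (simp add: tl_e_def tl_basis_def)
  then show "left_e n i x D = diagram_op n (\<lambda>A. circles n (turnback_diagram n i) A)
    (\<lambda>A. stack n (turnback_diagram n i) A) x D"
    using turnback_planar[OF assms] by (simp add: finite_planar_diagrams diagram_op_def)
qed

lemma diagram_op_comp:
  assumes "\<And>A. A \<in> planar_diagrams n \<Longrightarrow> s A \<in> planar_diagrams n"
  shows "diagram_op n c' s' (diagram_op n c s x) = diagram_op n (\<lambda>A. c A + c' (s A)) (\<lambda>A. s' (s A)) x"
proof (rule ext)
  fix D
  let ?P = "planar_diagrams n" and ?d = "q + inverse q"
  have "diagram_op n c' s' (diagram_op n c s x) D =
    (\<Sum>B\<in>?P. \<Sum>A\<in>?P. x A * (?d ^ c A * tl_basis (s A) B) * (?d ^ c' B * tl_basis (s' B) D))"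
    by (simp add: diagram_op_def sum_distrib_right)
  also have "\<dots> = (\<Sum>A\<in>?P. \<Sum>B\<in>?P. x A * (?d ^ c A * tl_basis (s A) B) * (?d ^ c' B * tl_basis (s' B) D))"
    by (rule sum.swap)
  also have "\<dots> = (\<Sum>A\<in>?P. \<Sum>B\<in>?P. if B = s A then x A * (?d ^ (c A + c' B) * tl_basis (s' B) D) else 0)"
    by (intro sum.cong refl) (simp add: tl_basis_def power_add)
  also have "\<dots> = diagram_op n (\<lambda>A. c A + c' (s A)) (\<lambda>A. s' (s A)) x D"
    unfolding diagram_op_def
    by (intro sum.cong refl) (simp add: finite_planar_diagrams assms)
  finally show "diagram_op n c' s' (diagram_op n c s x) D =
    diagram_op n (\<lambda>A. c A + c' (s A)) (\<lambda>A. s' (s A)) x D" .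
qed

lemma diagram_op_cong:
  "(\<And>A. A \<in> planar_diagrams n \<Longrightarrow> c A = c' A) \<Longrightarrow> (\<And>A. A \<in> planar_diagrams n \<Longrightarrow> s A = s' A) \<Longrightarrow>
   diagram_op n c s x = diagram_op n c' s' x"
  by (rule ext) (simp add: diagram_op_def)

lemma left_e_right_e:
  assumes "i \<in> {1..<n}" "k \<in> {1..<n}"
  shows "left_e n i (right_e n k x) = right_e n k (left_e n i x)"
  unfolding left_e_eq_op[OF assms(1)] right_e_eq_op[OF assms(2)]
  using assms stack_turnback_planar(1) turnback_stack_planar(1) turnbacks_commute
  by (simp add: diagram_op_comp cong: diagram_op_cong)

lemma diagram_op_sum:
  "diagram_op n c s (\<lambda>D. \<Sum>a\<in>S. f a * v a D) = (\<lambda>D. \<Sum>a\<in>S. f a * diagram_op n c s (v a) D)"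
  by (rule ext) (simp add: diagram_op_def sum_distrib_right sum_distrib_left sum.swap[of _ _ S] mult.assoc)

lemma diagram_op_diff:
  "diagram_op n c s (\<lambda>D. x D - y D) = (\<lambda>D. diagram_op n c s x D - diagram_op n c s y D)"
  by (rule ext) (simp add: diagram_op_def sum_subtractf algebra_simps)

lemma diagram_op_scale:
  "diagram_op n c s (\<lambda>D. b * x D) = (\<lambda>D. b * diagram_op n c s x D)"
  by (rule ext) (simp add: diagram_op_def sum_distrib_left mult.assoc)

lemma diagram_op_zero:
  assumes "\<And>A. A \<in> planar_diagrams n \<Longrightarrow> s A \<noteq> D"
  shows "diagram_op n c s x D = 0"
  unfolding diagram_op_def using assms by (intro sum.neutral) (auto simp: tl_basis_def)

section \<open>Effect of the generators on single coefficients\<close>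

context
  fixes n i :: nat
  assumes i: "i \<in> {1..<n}"
begin

lemma right_e_no_cap:
  assumes "((1, i), (1, Suc i)) \<notin> D"
  shows "right_e n i x D = 0"
  unfolding right_e_eq_op[OF i]
  using stack_turnback_planar(2)[OF i] assms by (intro diagram_op_zero) blast

lemma right_e_nonplanar: "D \<notin> planar_diagrams n \<Longrightarrow> right_e n i x D = 0"
  unfolding right_e_eq_op[OF i]
  using stack_turnback_planar(1)[OF i] by (intro diagram_op_zero) blast

lemma left_e_nonplanar: "D \<notin> planar_diagrams n \<Longrightarrow> left_e n i x D = 0"
  unfolding left_e_eq_op[OF i]
  using turnback_stack_planar(1)[OF _ i] by (intro diagram_op_zero) blast

lemma left_e_id_diagram: "left_e n i x (id_diagram n) = 0"
  unfolding left_e_eq_op[OF i]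
  using turnback_stack_planar(2)[OF _ i] id_diagram_no_cap(2) by (intro diagram_op_zero) metis

lemma cross_op_TL: "x \<in> TL n \<Longrightarrow> cross_op n x i \<in> TL n"
  by (simp add: TL_def cross_op_def right_e_nonplanar)

lemma cross_op_no_cap: "((1, i), (1, Suc i)) \<notin> D \<Longrightarrow> cross_op n x i D = x D"
  by (simp add: cross_op_def right_e_no_cap)

lemma cross_op_id_diagram: "cross_op n x i (id_diagram n) = x (id_diagram n)"
  by (rule cross_op_no_cap) (rule id_diagram_no_cap)

text \<open>A diagram with a cap on top is an eigenvector of \<open>I - q e\<^sub>i\<close> with eigenvalue
  \<open>1 - q (q + q\<^sup>-\<^sup>1) = - q\<^sup>2\<close>; all other diagrams contribute with a factor \<open>q\<close>.\<close>

lemma cross_op_cap: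
  assumes D: "D \<in> planar_diagrams n" "((1, i), (1, Suc i)) \<in> D"
    and x: "\<And>E. val_ge N (x E)"
  shows "val_ge (N + 1) (cross_op n x i D)"
proof -
  let ?t = "turnback_diagram n i"
  let ?Q = "{A \<in> planar_diagrams n. ((1, i), (1, Suc i)) \<notin> A}"
  let ?f = "\<lambda>A. x A * ((q + inverse q) ^ circles n A ?t * tl_basis (stack n A ?t) D)"
  \<comment> \<open>A diagram with the cap is reproduced by the turnback at the cost of one circle,
    so among these diagrams only \<open>D\<close> contributes to the coefficient of
    \<open>D\<close>.\<close>
  have "?f A = (if A = D then (q + inverse q) * x D else 0)"
    if "A \<in> planar_diagrams n - ?Q" for A
    using that stack_turnback_planar(3,4)[OF i, of A] by (auto simp: tl_basis_def mult.commute)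
  then have "sum ?f (planar_diagrams n - ?Q) =
    (\<Sum>A\<in>planar_diagrams n - ?Q. if A = D then (q + inverse q) * x D else 0)"
    by (intro sum.cong refl) simp
  also have "\<dots> = (q + inverse q) * x D"
    using D by (simp add: finite_planar_diagrams)
  finally have "right_e n i x D = (q + inverse q) * x D + sum ?f ?Q"
    unfolding right_e_eq_op[OF i] diagram_op_def
    using sum.subset_diff[of ?Q "planar_diagrams n" ?f] by (simp add: finite_planar_diagrams)
  moreover have "sum ?f ?Q = (\<Sum>A\<in>?Q. x A * tl_basis (stack n A ?t) D)"
    using stack_turnback_planar(3)[OF i] by (intro sum.cong refl) simp
  \<comment> \<open>The pole of the loop value is met here: \<open>q * inverse q = 1\<close> cancels
    the term \<open>x D\<close>, and everything left carries a factor q. The diagrams in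
    \<open>?Q\<close> close no circle, so they bring in no further pole.\<close>
  ultimately have "cross_op n x i D =
      - (q * (q * x D)) + - (q * (\<Sum>A\<in>?Q. x A * tl_basis (stack n A ?t) D))"
    using q_nonzero by (simp add: cross_op_def algebra_simps)
  moreover have 1: "val_ge (N + 1) (q * (q * x D))"
    using val_ge_q_mult[OF val_ge_q_mult[OF x[of D]]] by (rule val_ge_mono) simp
  moreover have 2: "val_ge N (\<Sum>A\<in>?Q. x A * tl_basis (stack n A ?t) D)"
    using x by (intro val_ge_sum) (simp add: tl_basis_def)
  ultimately show ?thesis
    by (simp only:) (intro val_ge_add val_ge_uminus 1 val_ge_q_mult[OF 2])
qed

lemma cross_op_val_ge:
  assumes "x \<in> TL n" "\<And>E. val_ge N (x E)"
  shows "val_ge N (cross_op n x i D)"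
proof (cases "D \<in> planar_diagrams n \<and> ((1, i), (1, Suc i)) \<in> D")
  case True
  then have "val_ge (N + 1) (cross_op n x i D)" using assms(2) by (intro cross_op_cap) auto
  then show ?thesis by (rule val_ge_mono) simp
next
  case False
  then show ?thesis
    using assms cross_op_TL[OF assms(1)] by (cases "D \<in> planar_diagrams n") (auto simp: TL_def cross_op_no_cap)
qed

lemma cross_op_sum:
  "cross_op n (\<lambda>D. \<Sum>a\<in>S. f a * v a D) i = (\<lambda>D. \<Sum>a\<in>S. f a * cross_op n (v a) i D)"
  by (rule ext) (simp add: cross_op_def right_e_eq_op[OF i] diagram_op_sum sum_distrib_left
      sum_subtractf algebra_simps)

lemma cross_op_diff:
  "cross_op n (\<lambda>D. x D - y D) i = (\<lambda>D. cross_op n x i D - cross_op n y i D)"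
  by (rule ext) (simp add: cross_op_def right_e_eq_op[OF i] diagram_op_diff algebra_simps)

lemma cross_op_scale: "cross_op n (tl_scale c x) i = tl_scale c (cross_op n x i)"
  by (rule ext) (simp add: cross_op_def right_e_eq_op[OF i] diagram_op_scale tl_scale_def algebra_simps)

lemma cross_op_eq_self_iff: "cross_op n x i = x \<longleftrightarrow> right_e n i x = tl_zero"
proof
  assume "cross_op n x i = x"
  then have "cross_op n x i D = x D" for D by simp
  then have "right_e n i x D = 0" for D
    using q_nonzero by (simp add: cross_op_def)
  then show "right_e n i x = tl_zero" by (auto simp: tl_zero_def)
qed (simp add: cross_op_def tl_zero_def)

lemma left_e_cross_op:
  assumes "k \<in> {1..<n}"
  shows "cross_op n (left_e n k x) i = left_e n k (cross_op n x i)"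
proof -
  have "left_e n k (cross_op n x i) = (\<lambda>D. left_e n k x D - q * left_e n k (right_e n i x) D)"
    unfolding cross_op_def left_e_eq_op[OF assms] by (simp add: diagram_op_diff diagram_op_scale)
  then show ?thesis by (simp add: cross_op_def left_e_right_e[OF assms i])
qed

end

section \<open>Contraction and the Jones-Wenzl projector\<close>

text \<open>A letter \<open>i\<close> improves the bound for every diagram with a cap at
  \<open>i\<close> and leaves the coefficients of all other diagrams untouched. Hence an improvement
  made by an earlier letter persists to the end of the word.\<close>

lemma foldl_cross_op_props:
  assumes "set w \<subseteq> {1..<n}" "x \<in> TL n" "x (id_diagram n) = 0" "\<And>D. val_ge N (x D)"
  shows "foldl (cross_op n) x w \<in> TL n \<and> foldl (cross_op n) x w (id_diagram n) = 0 \<and>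
    (\<forall>D. val_ge N (foldl (cross_op n) x w D)) \<and>
    (\<forall>D\<in>planar_diagrams n. (\<exists>i\<in>set w. ((1, i), (1, Suc i)) \<in> D) \<longrightarrow>
      val_ge (N + 1) (foldl (cross_op n) x w D))"
  using assms(1)
proof (induction w rule: rev_induct)
  case (snoc i w)
  then have i: "i \<in> {1..<n}" by simp
  define y where "y = foldl (cross_op n) x w"
  have y: "y \<in> TL n" "y (id_diagram n) = 0" "\<And>D. val_ge N (y D)"
    "\<And>D k. D \<in> planar_diagrams n \<Longrightarrow> k \<in> set w \<Longrightarrow> ((1, k), (1, Suc k)) \<in> D \<Longrightarrow> val_ge (N + 1) (y D)"
    using snoc unfolding y_def by auto
  have "val_ge (N + 1) (cross_op n y i D)"
    if D: "D \<in> planar_diagrams n" "k \<in> set (w @ [i])" "((1, k), (1, Suc k)) \<in> D" for D k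
  proof (cases "((1, i), (1, Suc i)) \<in> D")
    case True
    then show ?thesis using cross_op_cap[OF i D(1)] y(3) by blast
  next
    case False
    then have "k \<in> set w" using D by auto
    then show ?thesis using y(4) D False by (simp add: cross_op_no_cap[OF i])
  qed
  then show ?case
    using cross_op_TL[OF i y(1)] cross_op_id_diagram[OF i, of y] cross_op_val_ge[OF i y(1)] y(2,3)
    by (simp add: y_def[symmetric]) blast
qed (use assms in auto)

lemma foldl_cross_op_contracts:
  assumes "set w = {1..<n}" "x \<in> TL n" "x (id_diagram n) = 0" "\<And>D. val_ge N (x D)"
  shows "val_ge (N + 1) (foldl (cross_op n) x w D)"
proof -
  have w: "set w \<subseteq> {1..<n}" using assms(1) by simp
  note p = foldl_cross_op_props[OF w assms(2-4)]
  consider "D \<notin> planar_diagrams n" | "D = id_diagram n" | "D \<in> planar_diagrams n" "D \<noteq> id_diagram n"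
    by blast
  then show ?thesis
  proof cases
    case 1
    then show ?thesis using p by (simp add: TL_def)
  next
    case 2
    then show ?thesis using p by simp
  next
    case 3
    then show ?thesis using p exists_cap_planar[OF 3] assms(1) by blast
  qed
qed

lemma TL_val_ge_exists:
  assumes "x \<in> TL n"
  shows "\<exists>N. \<forall>D. val_ge N (x D)"
proof -
  have "\<forall>D. \<exists>N. val_ge N (x D)" using val_ge_exists by blast
  then obtain f where f: "\<And>D. val_ge (f D) (x D)" by metis
  define N where "N = Min (insert 0 (f ` planar_diagrams n))"
  have "val_ge N (x D)" for D
  proof (cases "D \<in> planar_diagrams n")
    case True
    then have "N \<le> f D" unfolding N_def by (simp add: finite_planar_diagrams)
    with f show ?thesis by (rule val_ge_mono)
  next
    case False
    then show ?thesis using assms by (simp add: TL_def)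
  qed
  then show ?thesis by blast
qed

text \<open>Repeating the contraction raises the valuation of a fixed vector beyond every bound.
  This serves four times: to normalize a fixed vector, to kill its products with e_k, to identify it
  with its mirror image, and to prove uniqueness.\<close>

lemma foldl_cross_op_fixed_eq_zero:
  assumes "set w = {1..<n}" "x \<in> TL n" "x (id_diagram n) = 0" "foldl (cross_op n) x w = x"
  shows "x = tl_zero"
proof -
  obtain N where N: "\<And>D. val_ge N (x D)" using TL_val_ge_exists[OF assms(2)] by blast
  have "val_ge (N + int k) (x D)" for k D
  proof (induction k arbitrary: D)
    case (Suc k)
    then have "val_ge (N + int k + 1) (foldl (cross_op n) x w D)"
      by (intro foldl_cross_op_contracts[OF assms(1-3)])
    moreover have "N + int k + 1 = N + int (Suc k)" by simp
    ultimately show ?case using assms(4) by metis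
  qed (simp add: N)
  then show ?thesis unfolding tl_zero_def by (intro ext val_ge_all)
qed

lemma foldl_cross_op_sum:
  assumes "set w \<subseteq> {1..<n}"
  shows "foldl (cross_op n) (\<lambda>D. \<Sum>a\<in>S. f a * v a D) w = (\<lambda>D. \<Sum>a\<in>S. f a * foldl (cross_op n) (v a) w D)"
  using assms by (induction w rule: rev_induct) (auto simp: cross_op_sum)

lemma foldl_cross_op_diff:
  assumes "set w \<subseteq> {1..<n}"
  shows "foldl (cross_op n) (\<lambda>D. x D - y D) w =
    (\<lambda>D. foldl (cross_op n) x w D - foldl (cross_op n) y w D)"
  using assms by (induction w rule: rev_induct) (auto simp: cross_op_diff)

lemma foldl_cross_op_scale:
  assumes "set w \<subseteq> {1..<n}"
  shows "foldl (cross_op n) (tl_scale c x) w = tl_scale c (foldl (cross_op n) x w)"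
  using assms by (induction w rule: rev_induct) (auto simp: cross_op_scale)

lemma foldl_cross_op_TL:
  assumes "set w \<subseteq> {1..<n}" "x \<in> TL n"
  shows "foldl (cross_op n) x w \<in> TL n \<and> foldl (cross_op n) x w (id_diagram n) = x (id_diagram n)"
  using assms by (induction w rule: rev_induct) (auto simp: cross_op_TL cross_op_id_diagram)

lemma foldl_cross_op_left_e:
  assumes "set w \<subseteq> {1..<n}" "k \<in> {1..<n}"
  shows "foldl (cross_op n) (left_e n k x) w = left_e n k (foldl (cross_op n) x w)"
  using assms(1) by (induction w rule: rev_induct) (auto simp: left_e_cross_op[OF _ assms(2)])

lemma foldl_cross_op_fixed:
  assumes "\<And>i. i \<in> set w \<Longrightarrow> cross_op n x i = x"
  shows "foldl (cross_op n) x w = x"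
  using assms by (induction w rule: rev_induct) auto

text \<open>The space of fixed vectors of the product of all generators is nontrivial, because this
  product preserves the coefficient of the identity diagram.\<close>

lemma cross_op_fixed_vector_exists:
  assumes w: "set w = {1..<n}"
  shows "\<exists>x\<in>TL n. x (id_diagram n) = 1 \<and> foldl (cross_op n) x w = x"
proof -
  let ?P = "planar_diagrams n" and ?I = "id_diagram n"
  let ?F = "\<lambda>x. foldl (cross_op n) x w"
  have w': "set w \<subseteq> {1..<n}" using w by simp
  \<comment> \<open>The fixed-point equation at the identity diagram holds for every vector, which
    leaves one equation fewer than unknowns.\<close>
  have "card (?P - {?I}) < card ?P"
    using finite_planar_diagrams id_diagram_planar by (meson card_Diff1_less)
  then obtain c where c: "\<exists>A\<in>?P. c A \<noteq> 0"
    "\<And>D. D \<in> ?P - {?I} \<Longrightarrow> (\<Sum>A\<in>?P. c A * (?F (tl_basis A) D - tl_basis A D)) = 0"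
    using homogeneous_system_nontrivial[of "?P - {?I}" ?P
        "\<lambda>A D. ?F (tl_basis A) D - tl_basis A D"] finite_planar_diagrams by auto
  define x where "x = (\<lambda>D. \<Sum>A\<in>?P. c A * tl_basis A D)"
  have xc: "x D = (if D \<in> ?P then c D else 0)" for D
  proof -
    have "x D = (\<Sum>A\<in>?P. if A = D then c A else 0)"
      unfolding x_def by (intro sum.cong refl) (simp add: tl_basis_def)
    then show ?thesis by (simp add: finite_planar_diagrams)
  qed
  have xTL: "x \<in> TL n" by (simp add: TL_def xc)
  note FTL = foldl_cross_op_TL[OF w' xTL]
  have Fx: "?F x = x"
  proof
    fix D
    consider "D \<notin> ?P" | "D = ?I" | "D \<in> ?P - {?I}" by blast
    then show "?F x D = x D"
    proof cases
      case 1
      then show ?thesis using FTL xTL by (simp add: TL_def)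
    next
      case 2
      then show ?thesis using FTL by simp
    next
      case 3
      have "?F x D - x D = (\<Sum>A\<in>?P. c A * (?F (tl_basis A) D - tl_basis A D))"
        unfolding x_def foldl_cross_op_sum[OF w'] by (simp add: sum_subtractf algebra_simps)
      then show ?thesis using c(2)[OF 3] by simp
    qed
  qed
  have "x ?I \<noteq> 0"
  proof
    assume "x ?I = 0"
    with foldl_cross_op_fixed_eq_zero[OF w xTL _ Fx] have "x = tl_zero" by simp
    with c(1) xc show False by (metis tl_zero_def)
  qed
  moreover have "tl_scale (inverse (x ?I)) x \<in> TL n" using xTL by (simp add: TL_def tl_scale_def)
  moreover have "?F (tl_scale (inverse (x ?I)) x) = tl_scale (inverse (x ?I)) x"
    unfolding foldl_cross_op_scale[OF w'] Fx ..
  ultimately show ?thesis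
    by (intro bexI[of _ "tl_scale (inverse (x ?I)) x"]) (simp_all add: tl_scale_def)
qed

text \<open>The mirror image is an anti-automorphism of the algebra. Elements are coefficient
  functions, so it acts by precomposition with \<open>flip\<close>, and the sums are reindexed along
  that bijection.\<close>

lemma tl_mult_flip:
  "tl_mult n (x \<circ> flip) (y \<circ> flip) = tl_mult n y x \<circ> flip"
proof (rule ext)
  fix D
  let ?P = "planar_diagrams n" and ?d = "q + inverse q"
  have "tl_mult n (x \<circ> flip) (y \<circ> flip) D = (\<Sum>A\<in>?P. \<Sum>B\<in>?P.
    x A * y B * (?d ^ circles n (flip A) (flip B) * tl_basis (stack n (flip A) (flip B)) D))"
  proof -
    have re: "sum g ?P = (\<Sum>A\<in>?P. g (flip A))" for g :: "diagram \<Rightarrow> ratfun"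
      using sum.reindex_bij_betw[OF bij_betw_flip, of g n] by simp
    let ?g = "\<lambda>A B. x (flip A) * y (flip B) * (?d ^ circles n A B * tl_basis (stack n A B) D)"
    have "(\<Sum>A\<in>?P. \<Sum>B\<in>?P. ?g A B) = (\<Sum>A\<in>?P. \<Sum>B\<in>?P. ?g (flip A) B)"
      by (rule re)
    also have "\<dots> = (\<Sum>A\<in>?P. \<Sum>B\<in>?P. ?g (flip A) (flip B))"
      by (intro sum.cong refl re)
    finally show ?thesis unfolding tl_mult_def comp_def flip_flip .
  qed
  also have "\<dots> = (\<Sum>A\<in>?P. \<Sum>B\<in>?P.
    y B * x A * (?d ^ circles n B A * tl_basis (stack n B A) (flip D)))"
  proof (intro sum.cong refl)
    fix A B assume "A \<in> ?P" "B \<in> ?P"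
    then have "A \<subseteq> endpoints n \<times> endpoints n" "B \<subseteq> endpoints n \<times> endpoints n"
      using planar_diagrams_subset by auto
    moreover have "D = flip (stack n B A) \<longleftrightarrow> flip D = stack n B A" by (metis flip_flip)
    ultimately show "x A * y B * (?d ^ circles n (flip A) (flip B) * tl_basis (stack n (flip A) (flip B)) D) =
      y B * x A * (?d ^ circles n B A * tl_basis (stack n B A) (flip D))"
      by (simp add: flip_stack flip_circles tl_basis_def mult.commute)
  qed
  also have "\<dots> = (tl_mult n y x \<circ> flip) D"
    unfolding tl_mult_def comp_def by (rule sum.swap)
  finally show "tl_mult n (x \<circ> flip) (y \<circ> flip) D = (tl_mult n y x \<circ> flip) D" .
qed

lemma right_e_flip: "right_e n i (x \<circ> flip) = left_e n i x \<circ> flip"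
proof -
  have "tl_e n i \<circ> flip = tl_e n i"
    by (rule ext) (metis comp_apply flip_flip flip_turnback_diagram tl_basis_def tl_e_def)
  with tl_mult_flip[of n x "tl_e n i"] show ?thesis by (simp add: right_e_def left_e_def)
qed

lemma is_jones_wenzl_exists: "\<exists>P. is_jones_wenzl n P"
proof -
  define w where "w = [1..<n]"
  have w: "set w = {1..<n}" "set w \<subseteq> {1..<n}" by (simp_all add: w_def)
  obtain x where x: "x \<in> TL n" "x (id_diagram n) = 1" "foldl (cross_op n) x w = x"
    using cross_op_fixed_vector_exists[OF w(1)] by blast
  have left: "left_e n k x = tl_zero" if k: "k \<in> {1..<n}" for k
    using foldl_cross_op_left_e[OF w(2) k, of x] x left_e_nonplanar[OF k] left_e_id_diagram[OF k]
    by (intro foldl_cross_op_fixed_eq_zero[OF w(1)]) (simp_all add: TL_def)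
  define y where "y = x \<circ> flip"
  have y: "y \<in> TL n" "y (id_diagram n) = 1"
    using x flip_planar_diagrams flip_id_diagram
    by (simp_all add: y_def TL_def) (metis flip_flip)
  have right: "right_e n k y = tl_zero" if "k \<in> {1..<n}" for k
    unfolding y_def right_e_flip left[OF that] by (auto simp: tl_zero_def)
  then have "foldl (cross_op n) y w = y"
    using w by (intro foldl_cross_op_fixed) (simp add: cross_op_eq_self_iff)
  then have "(\<lambda>D. x D - y D) = tl_zero"
    using x y foldl_cross_op_diff[OF w(2), of x y]
    by (intro foldl_cross_op_fixed_eq_zero[OF w(1)]) (simp_all add: TL_def)
  then have "x = y" by (auto simp: tl_zero_def fun_eq_iff)
  with x right left have "is_jones_wenzl n x"
    by (simp add: is_jones_wenzl_def right_e_def left_e_def)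
  then show ?thesis by blast
qed

lemma is_jones_wenzl_cross_op:
  "is_jones_wenzl n P \<Longrightarrow> i \<in> {1..<n} \<Longrightarrow> cross_op n P i = P"
  by (simp add: cross_op_eq_self_iff is_jones_wenzl_def right_e_def)

lemma is_jones_wenzl_unique:
  assumes "is_jones_wenzl n P" "is_jones_wenzl n P'"
  shows "P = P'"
proof -
  have w: "set [1..<n] = {1..<n}" "set [1..<n] \<subseteq> {1..<n}" by simp_all
  have "foldl (cross_op n) P [1..<n] = P" "foldl (cross_op n) P' [1..<n] = P'"
    using assms is_jones_wenzl_cross_op by (intro foldl_cross_op_fixed; simp)+
  then have "(\<lambda>D. P D - P' D) = tl_zero"
    using assms foldl_cross_op_diff[OF w(2), of P P']
    by (intro foldl_cross_op_fixed_eq_zero[OF w(1)]) (simp_all add: TL_def is_jones_wenzl_def)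
  then show ?thesis by (auto simp: tl_zero_def fun_eq_iff)
qed

lemma is_jones_wenzl_jones_wenzl: "is_jones_wenzl n (jones_wenzl n)"
  unfolding jones_wenzl_def
  using is_jones_wenzl_exists is_jones_wenzl_unique by (metis theI)

section \<open>The Kauffman bracket\<close>

lemma tl_mult_one_right:
  assumes "x \<in> TL n"
  shows "tl_mult n x (tl_one n) = x"
proof (rule ext)
  fix D
  let ?P = "planar_diagrams n"
  have "tl_mult n x (tl_one n) D = (\<Sum>A\<in>?P. \<Sum>B\<in>?P. if B = id_diagram n
    then x A * ((q + inverse q) ^ circles n A B * tl_basis (stack n A B) D) else 0)"
    unfolding tl_mult_def by (intro sum.cong refl) (simp add: tl_one_def tl_basis_def)
  also have "\<dots> = (\<Sum>A\<in>?P. if A = D then x A else 0)"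
    using id_diagram_planar
    by (intro sum.cong refl) (simp add: finite_planar_diagrams stack_id_planar tl_basis_def)
  also have "\<dots> = x D"
    using assms by (simp add: finite_planar_diagrams TL_def)
  finally show "tl_mult n x (tl_one n) D = x D" .
qed

lemma tl_mult_crossing_bracket:
  assumes "x \<in> TL n"
  shows "tl_mult n x (crossing_bracket n i s) =
    tl_scale (if s then q else - (q powi - 2)) (cross_op n x i)"
proof -
  have lin: "tl_mult n x (tl_add (tl_scale a y) (tl_scale b z)) =
    (\<lambda>D. a * tl_mult n x y D + b * tl_mult n x z D)" for a b y z
    by (rule ext) (simp add: tl_mult_def tl_add_def tl_scale_def sum_distrib_left
        sum.distrib[symmetric] algebra_simps)
  \<comment> \<open>This puts the negative crossing into the form - q^(-2) (1 - q e_i).\<close>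
  have "q powi - 2 * q = q powi - 1"
    using power_int_add_1[of q "- 2"] q_nonzero by simp
  then show ?thesis
    unfolding crossing_bracket_def
    by (cases s; simp only: if_True if_False lin tl_mult_one_right[OF assms])
      (auto simp: tl_scale_def cross_op_def right_e_def fun_eq_iff algebra_simps power2_eq_square)
qed

lemma length_crossing_signs: "length (crossing_signs up w) = length w"
  by (induction up w rule: crossing_signs.induct) (auto simp: comp_def)

text \<open>The sign list is arbitrary because the signs of the tail belong to a permuted
  orientation. The starting element is arbitrary because each crossing leaves a scalar multiple
  behind.\<close>

lemma foldl_crossing_bracket:
  assumes "x \<in> TL n" "set w \<subseteq> {1..<n}" "length s = length w"
  shows "foldl (\<lambda>x (i, s). tl_mult n x (crossing_bracket n i s)) x (zip w s) =
    tl_scale (\<Prod>s\<leftarrow>s. if s then q else - (q powi - 2)) (foldl (cross_op n) x w)"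
  using assms
proof (induction w arbitrary: x s)
  case (Cons i w)
  obtain b s' where s: "s = b # s'" using Cons.prems(3) by (cases s) auto
  define c where "c = (if b then q else - (q powi - 2))"
  have i: "i \<in> {1..<n}" and w: "set w \<subseteq> {1..<n}" using Cons.prems(2) by auto
  have "tl_scale c (cross_op n x i) \<in> TL n"
    using cross_op_TL[OF i Cons.prems(1)] by (simp add: TL_def tl_scale_def)
  from Cons.IH[OF this w, of s'] Cons.prems(3) show ?case
    unfolding s by (simp add: tl_mult_crossing_bracket[OF Cons.prems(1)] c_def[symmetric]
        foldl_cross_op_scale[OF w]) (simp add: tl_scale_def mult_ac)
qed (auto simp: tl_scale_def)

text \<open>A positive crossing has the scalar q, cancelled by its share q^(-1) of the
  normalization; a negative one has - q^(-2), cancelled by - q^2. This is the origin of the weights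
  1 and -2 in N.\<close>

lemma normalization_factor:
  "(-1) ^ length (filter (\<lambda>s. \<not> s) s) *
    q powi (- (int (length (filter (\<lambda>s. s) s)) - 2 * int (length (filter (\<lambda>s. \<not> s) s)))) *
    (\<Prod>s\<leftarrow>s. if s then q else - (q powi - 2)) = 1"
proof (induction s)
  case (Cons b s)
  let ?p = "int (length (filter (\<lambda>s. s) s))" and ?m = "length (filter (\<lambda>s. \<not> s) s)"
  let ?P = "\<Prod>s\<leftarrow>s. if s then q else - (q powi - 2)"
  have pos: "q powi (- (1 + ?p - 2 * int ?m)) * q = q powi (- (?p - 2 * int ?m))"
    using power_int_add_1[of q "- (1 + ?p - 2 * int ?m)"] q_nonzero by (simp add: algebra_simps)
  have neg: "q powi (- (?p - 2 * (1 + int ?m))) * q powi - 2 = q powi (- (?p - 2 * int ?m))"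
    using power_int_add[of q "- (?p - 2 * (1 + int ?m))" "- 2"] q_nonzero by (simp add: algebra_simps)
  have "(-1) ^ ?m * (q powi (- (1 + ?p - 2 * int ?m)) * q) * ?P = 1"
    "(-1) ^ ?m * (q powi (- (?p - 2 * (1 + int ?m))) * q powi - 2) * ?P = 1"
    unfolding pos neg by (rule Cons.IH)+
  then show ?case
    by (cases b) (simp_all add: mult_ac)
qed simp

lemma tl_one_TL: "tl_one n \<in> TL n"
  using id_diagram_planar by (auto simp: TL_def tl_one_def tl_basis_def)

lemma normalized_bracket_eq_foldl:
  assumes "set w \<subseteq> {1..<n}"
  shows "normalized_bracket n up w = foldl (cross_op n) (tl_one n) w"
  using normalization_factor[of "crossing_signs up w"]
  unfolding normalized_bracket_def kauffman_bracket_def n_plus_def n_minus_def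
    foldl_crossing_bracket[OF tl_one_TL assms length_crossing_signs]
  by (simp add: tl_scale_def mult.assoc[symmetric])

lemma crossing_signs_upward:
  assumes "\<forall>i\<in>{1..n}. up i" "set w \<subseteq> {1..<n}"
  shows "crossing_signs up w = replicate (length w) True"
  using assms
proof (induction w arbitrary: up)
  case (Cons i w)
  then have i: "i \<in> {1..n}" "Suc i \<in> {1..n}" by auto
  then have "\<forall>k\<in>{1..n}. (up \<circ> transpose i (Suc i)) k"
    using Cons.prems(1) by (auto simp: transpose_def)
  with Cons i show ?case by simp
qed simp

lemma normalized_bracket_upward:
  assumes "\<forall>i\<in>{1..n}. up i" "set w \<subseteq> {1..<n}"
  shows "normalized_bracket n up w = tl_scale (q powi (- int (length w))) (kauffman_bracket n up w)"
  unfolding normalized_bracket_def n_plus_def n_minus_def crossing_signs_upward[OF assms] by simp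

theorem corollary1p2:
  fixes n :: nat and j :: "nat \<Rightarrow> nat" and up :: "nat \<Rightarrow> bool"
  assumes "semi_infinite_positive_braid n j"
    and "complete_braid n j"
  shows "((\<forall>i\<in>{1..n}. up i) \<longrightarrow>
           (\<forall>l. normalized_bracket n up (partial_braid j l) =
                tl_scale (q powi (- int l)) (kauffman_bracket n up (partial_braid j l)))) \<and>
         (\<forall>D\<in>planar_diagrams n. \<exists>f :: complex fps.
            expansion (jones_wenzl n D) = fps_to_fls f \<and>
            (\<forall>m :: int. \<forall>\<^sub>F l in sequentially.
               fls_nth (expansion (normalized_bracket n up (partial_braid j l) D)) m =
               fls_nth (fps_to_fls f) m))"
proof (intro conjI impI allI ballI)
  have jn: "j m \<in> {1..<n}" for m using assms(1) by (simp add: semi_infinite_positive_braid_def)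
  have sub: "set (map j [l..<l']) \<subseteq> {1..<n}" for l l' using jn by auto
  then have pb: "set (partial_braid j l) \<subseteq> {1..<n}" for l by (simp add: partial_braid_def)
  show "normalized_bracket n up (partial_braid j l) =
      tl_scale (q powi (- int l)) (kauffman_bracket n up (partial_braid j l))"
    if "\<forall>i\<in>{1..n}. up i" for l
    using normalized_bracket_upward[OF that pb, of l] by (simp add: partial_braid_def)
  let ?P = "jones_wenzl n"
  let ?y = "\<lambda>l. foldl (cross_op n) (tl_one n) (map j [0..<l])"
  define z where "z l = (\<lambda>D. ?y l D - ?P D)" for l
  have P: "?P \<in> TL n" "?P (id_diagram n) = 1" "\<And>i. i \<in> {1..<n} \<Longrightarrow> cross_op n ?P i = ?P"
    using is_jones_wenzl_jones_wenzl[of n] is_jones_wenzl_cross_op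
    by (simp_all add: is_jones_wenzl_def)
  have zfold: "z l' = foldl (cross_op n) (z l) (map j [l..<l'])" if "l \<le> l'" for l l'
  proof -
    have "foldl (cross_op n) ?P (map j [l..<l']) = ?P"
      using jn P(3) by (intro foldl_cross_op_fixed) auto
    moreover have "?y l' = foldl (cross_op n) (?y l) (map j [l..<l'])"
      using that by (metis foldl_append map_append upt_add_eq_append le0 le_add_diff_inverse)
    ultimately show ?thesis
      unfolding z_def foldl_cross_op_diff[OF sub] by simp
  qed
  have z: "z l \<in> TL n \<and> z l (id_diagram n) = 0" for l
    using foldl_cross_op_TL[OF sub tl_one_TL, of 0 l] P(1,2)
    by (simp add: z_def TL_def tl_one_def tl_basis_def)
  have later: "val_ge N (z l' D)" if "\<And>D. val_ge N (z l D)" "l \<le> l'" for N l l' D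
    using foldl_cross_op_props[OF sub _ _ that(1)] z zfold[OF that(2)] by simp
  obtain N where N: "\<And>D. val_ge N (z 0 D)" using TL_val_ge_exists z by blast
  have conv: "\<exists>L. \<forall>l\<ge>L. \<forall>D. val_ge (N + int k) (z l D)" for k
  proof (induction k)
    case 0
    then show ?case using later[OF N] by (intro exI[of _ 0]) simp
  next
    case (Suc k)
    then obtain L where L: "\<And>D. val_ge (N + int k) (z L D)" by blast
    \<comment> \<open>Completeness guarantees that each generator recurs after any given stage, so
      the braid splits into infinitely many blocks to which the contraction applies.\<close>
    have "\<exists>m\<ge>L. j m = i" if "i \<in> {1..<n}" for i
      using assms(2) that unfolding complete_braid_def infinite_nat_iff_unbounded_le by blast
    then obtain g where g: "\<And>i. i \<in> {1..<n} \<Longrightarrow> L \<le> g i \<and> j (g i) = i" by metis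
    \<comment> \<open>The sum is a crude common upper bound for all \<open>g i\<close>, and
      \<open>Suc\<close> makes it strict, so the block from \<open>L\<close> up to \<open>L'\<close>
      contains every generator.\<close>
    define L' where "L' = Suc (L + sum g {1..<n})"
    have "g i < L'" if "i \<in> {1..<n}" for i
      unfolding L'_def using member_le_sum[of i "{1..<n}" g] that by simp
    then have "i \<in> set (map j [L..<L'])" if "i \<in> {1..<n}" for i
      using g[OF that] that by (auto intro!: image_eqI[of _ _ "g i"])
    with sub have "set (map j [L..<L']) = {1..<n}" by blast
    moreover have "L \<le> L'" unfolding L'_def by simp
    ultimately have "val_ge (N + int (Suc k)) (z L' D)" for D
      using foldl_cross_op_contracts[of "map j [L..<L']" n "z L" "N + int k"] z L zfold
      by (simp add: algebra_simps)
    then show ?case using later by blast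
  qed
  have stable: "\<forall>\<^sub>F l in sequentially. fls_nth (expansion (?y l D)) m = fls_nth (expansion (?P D)) m" for m D
  proof -
    obtain L where L: "\<And>l. L \<le> l \<Longrightarrow> val_ge (N + int (nat (m + 1 - N))) (z l D)"
      using conv by blast
    have "fls_nth (expansion (?y l D)) m = fls_nth (expansion (?P D)) m" if "L \<le> l" for l
      using L[OF that] by (simp add: val_ge_def z_def)
    then show ?thesis unfolding eventually_sequentially by blast
  qed
  \<comment> \<open>The products start at the identity, which has no pole, and
    \<open>cross_op\<close> preserves the bound 0.\<close>
  have integral: "val_ge 0 (?y l D)" for l D
  proof (induction l arbitrary: D)
    case 0
    then show ?case by (simp add: tl_one_def tl_basis_def val_ge_def)
  next
    case (Suc l)
    then show ?case
      using foldl_cross_op_TL[OF sub tl_one_TL, of 0 l] by (simp add: cross_op_val_ge[OF jn])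
  qed
  fix D assume "D \<in> planar_diagrams n"
  \<comment> \<open>Each coefficient of negative index agrees with that of some partial bracket and
    therefore vanishes. This excludes a pole of the projector at q = 0 and makes its expansion a
    power series.\<close>
  have "fls_nth (expansion (?P D)) m = 0" if "m < 0" for m
    using eventually_happens'[OF _ stable[of D m]] integral that by (auto simp: val_ge_def)
  then have "fps_to_fls (fls_regpart (expansion (?P D))) = expansion (?P D)"
    by (cases "?P D = 0") (auto intro!: fls_regpart_to_fls_trivial fls_subdegree_geI)
  moreover have "normalized_bracket n up (partial_braid j l) = ?y l" for l
    using normalized_bracket_eq_foldl[OF pb] by (simp add: partial_braid_def)
  ultimately show "\<exists>f. expansion (?P D) = fps_to_fls f \<and>
      (\<forall>m. \<forall>\<^sub>F l in sequentially. fls_nth (expansion (normalized_bracket n up (partial_braid j l) D)) m =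
        fls_nth (fps_to_fls f) m)"
    using stable by (intro exI[of _ "fls_regpart (expansion (?P D))"]) simp
qed

end
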